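(* Let $R=D[X;\sigma,\delta]$ be an Ore extension of a skew field $D$ (with $\sigma$ an automorphism of $D$ and $\delta$ a $\sigma$-derivation) satisfying: (1) $R$ is a free module of finite rank $r$ over its center $C$; (2) $C=K[z]$, where $K$ is a commutative subfield of the center of $D$ invariant under $\sigma$ and such that $\delta(K)=0$, and $z\in R$ is a (central) nonconstant polynomial; (3) every nonzero twosided polynomial of $R$ is, up to multiplication by a constant in $D$, of the form $X^m\alpha$ with $\alpha\in K[z]$ and $m\ge0$. Let $f\in R$ be such that $f^*\in K[z]$ is irreducible. Put $K_f=K[z]/K[z]f^*$, $A=R/Rf^*$, $a=f+Rf^*\in A$, and let $e\in A$ be an idempotent such that $Ae=Aa$. Then $f$ is reducible if and only if the $K_f$-algebra $(1-e)A(1-e)$ has zero divisors. Moreover, each zero divisor allows one to compute a proper factorization $f=h_1h$ where $f^*=h^*=h_1^*$.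
   Context: A $\sigma$-derivation is an additive map $\delta:D\to D$ with $\delta(ab)=\sigma(a)\delta(b)+\delta(a)b$. $R=D[X;\sigma,\delta]$ has left $D$-basis $\{X^n:n\ge0\}$ and $Xa=\sigma(a)X+\delta(a)$ for $a\in D$; it is a left and right principal ideal domain. A polynomial $\alpha$ is twosided if $R\alpha=\alpha R$. A bound $f^*$ of $f$ is a polynomial with $Rf^*=f^*R=\operatorname{Ann}_R(R/Rf)$ (the largest twosided ideal contained in $Rf$), determined up to left multiplication by nonzero elements of $D$; "$f^*\in K[z]$ is irreducible" means that a bound is chosen in $K[z]$ and is irreducible as a polynomial in $K[z]$, and equalities of bounds are up to multiplication by nonzero elements of $D$. Zero divisors are understood to be nonzero. A factorization is proper if neither factor is a unit. The arithmetic of $D,\sigma,\delta$ is assumed effective, so that Euclidean divisions and right greatest common divisors in $R$ are computable.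
   Formalization: The equality f*=h*=h_1* is claimed only if no twosided X^m with m>0 has Rf* strictly inside RX^m. Otherwise it is false: D=F_4, σ Frobenius, δ=0, z=X^2, f=X^2 has f*=X^2, but its proper factors are constants times X, with bound X. *)

theory Defs
  imports "HOL-Algebra.QuotRing" "HOL-Algebra.Ring_Divisibility" "HOL-Algebra.Module"
    "HOL-Computational_Algebra.Polynomial"
begin

hide_const (open) Polynomial.smult

section \<open>Ore extensions of a skew field\<close>

definition skew_automorphism :: "('a::division_ring \<Rightarrow> 'a) \<Rightarrow> bool" where
  "skew_automorphism \<sigma> \<longleftrightarrow>
     bij \<sigma> \<and> \<sigma> 1 = 1 \<and> (\<forall>a b. \<sigma> (a + b) = \<sigma> a + \<sigma> b) \<and> (\<forall>a b. \<sigma> (a * b) = \<sigma> a * \<sigma> b)"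

definition skew_derivation :: "('a::division_ring \<Rightarrow> 'a) \<Rightarrow> ('a \<Rightarrow> 'a) \<Rightarrow> bool" where
  "skew_derivation \<sigma> \<delta> \<longleftrightarrow>
     (\<forall>a b. \<delta> (a + b) = \<delta> a + \<delta> b) \<and> (\<forall>a b. \<delta> (a * b) = \<sigma> a * \<delta> b + \<delta> a * b)"

text \<open>
  Elements of \<open>D[X;\<sigma>,\<delta>]\<close> are represented by their left coefficients, i.e. the polynomial with
  coefficients \<open>a\<^sub>i\<close> stands for the sum of the \<open>a\<^sub>i X\<^sup>i\<close>. From the library type only the additive
  group is used; the product of the type class (which needs commutative coefficients) is not.
\<close>

definition scale_left :: "'a::division_ring \<Rightarrow> 'a poly \<Rightarrow> 'a poly" where
  "scale_left c p = map_poly (\<lambda>x. c * x) p"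

text \<open>Left multiplication by \<open>X\<close>, from \<open>X b = \<sigma>(b) X + \<delta>(b)\<close>.\<close>

definition times_X :: "('a::division_ring \<Rightarrow> 'a) \<Rightarrow> ('a \<Rightarrow> 'a) \<Rightarrow> 'a poly \<Rightarrow> 'a poly" where
  "times_X \<sigma> \<delta> p = pCons 0 (map_poly \<sigma> p) + map_poly \<delta> p"

definition ore_mult ::
  "('a::division_ring \<Rightarrow> 'a) \<Rightarrow> ('a \<Rightarrow> 'a) \<Rightarrow> 'a poly \<Rightarrow> 'a poly \<Rightarrow> 'a poly" where
  "ore_mult \<sigma> \<delta> p q = (\<Sum>i\<le>degree p. scale_left (coeff p i) ((times_X \<sigma> \<delta> ^^ i) q))"

definition ore_extension ::
  "('a::division_ring \<Rightarrow> 'a) \<Rightarrow> ('a \<Rightarrow> 'a) \<Rightarrow> 'a poly ring" where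
  "ore_extension \<sigma> \<delta> =
     \<lparr>carrier = UNIV, mult = ore_mult \<sigma> \<delta>, one = [:1:], zero = 0, add = (+)\<rparr>"

definition ore_X :: "'a::division_ring poly" where
  "ore_X = [:0, 1:]"

lemma coeff_scale_left: "coeff (scale_left c p) n = c * coeff p n"
  by (simp add: scale_left_def coeff_map_poly)

lemma scale_left_add: "scale_left c (p + q) = scale_left c p + scale_left c q"
  by (simp add: poly_eq_iff coeff_scale_left distrib_left)

lemma scale_left_add_left: "scale_left (c + d) p = scale_left c p + scale_left d p"
  by (simp add: poly_eq_iff coeff_scale_left distrib_right)

lemma scale_left_simps [simp]:
  "scale_left 0 p = 0" "scale_left 1 p = p" "scale_left c 0 = 0"
  "scale_left c (scale_left d p) = scale_left (c * d) p"
  by (simp_all add: poly_eq_iff coeff_scale_left mult.assoc)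

lemma scale_left_sum: "scale_left c (\<Sum>i\<in>A. g i) = (\<Sum>i\<in>A. scale_left c (g i))"
  by (induction A rule: infinite_finite_induct) (simp_all add: scale_left_add)

context
  fixes \<sigma> \<delta> :: "'a::division_ring \<Rightarrow> 'a"
  assumes aut: "skew_automorphism \<sigma>" and der: "skew_derivation \<sigma> \<delta>"
begin

lemma sigma_delta:
  "\<sigma> 0 = 0" "\<delta> 0 = 0" "\<sigma> 1 = 1" "\<delta> 1 = 0" "\<sigma> (a + b) = \<sigma> a + \<sigma> b" "\<delta> (a + b) = \<delta> a + \<delta> b"
  "\<sigma> (a * b) = \<sigma> a * \<sigma> b" "\<delta> (a * b) = \<sigma> a * \<delta> b + \<delta> a * b"
proof -
  show s: "\<sigma> 1 = 1" "\<sigma> (a + b) = \<sigma> a + \<sigma> b" "\<delta> (a + b) = \<delta> a + \<delta> b"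
    "\<sigma> (a * b) = \<sigma> a * \<sigma> b" "\<delta> (a * b) = \<sigma> a * \<delta> b + \<delta> a * b"
    using aut der by (simp_all add: skew_automorphism_def skew_derivation_def)
  have "\<sigma> (0 + 0) = \<sigma> 0 + \<sigma> 0" "\<delta> (0 + 0) = \<delta> 0 + \<delta> 0"
    using aut der unfolding skew_automorphism_def skew_derivation_def by blast+
  then show "\<sigma> 0 = 0" "\<delta> 0 = 0" by simp_all
  have "\<delta> (1 * 1) = \<sigma> 1 * \<delta> 1 + \<delta> 1 * 1"
    using der unfolding skew_derivation_def by blast
  with s(1) show "\<delta> 1 = 0" by simp
qed

lemma coeff_times_X:
  "coeff (times_X \<sigma> \<delta> p) n = (case n of 0 \<Rightarrow> 0 | Suc m \<Rightarrow> \<sigma> (coeff p m)) + \<delta> (coeff p n)"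
  by (simp add: times_X_def coeff_map_poly sigma_delta coeff_pCons split: nat.split)

lemma times_X_add: "times_X \<sigma> \<delta> (p + q) = times_X \<sigma> \<delta> p + times_X \<sigma> \<delta> q"
  by (simp add: poly_eq_iff coeff_times_X sigma_delta split: nat.split)

lemma times_X_0: "times_X \<sigma> \<delta> 0 = 0"
  by (simp add: times_X_def)

lemma times_X_scale:
  "times_X \<sigma> \<delta> (scale_left c p) = scale_left (\<sigma> c) (times_X \<sigma> \<delta> p) + scale_left (\<delta> c) p"
  by (simp add: poly_eq_iff coeff_times_X coeff_scale_left sigma_delta distrib_left add.assoc
      split: nat.split)

lemma times_X_sum: "times_X \<sigma> \<delta> (\<Sum>i\<in>A. g i) = (\<Sum>i\<in>A. times_X \<sigma> \<delta> (g i))"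
  by (induction A rule: infinite_finite_induct) (simp_all add: times_X_add times_X_0)

lemma times_X_pow_add:
  "(times_X \<sigma> \<delta> ^^ i) (p + q) = (times_X \<sigma> \<delta> ^^ i) p + (times_X \<sigma> \<delta> ^^ i) q"
  by (induction i) (simp_all add: times_X_add)

lemma ore_mult_bound:
  assumes "degree p \<le> n"
  shows "ore_mult \<sigma> \<delta> p q = (\<Sum>i\<le>n. scale_left (coeff p i) ((times_X \<sigma> \<delta> ^^ i) q))"
  unfolding ore_mult_def using assms
  by (intro sum.mono_neutral_left) (auto simp: coeff_eq_0)

lemma ore_mult_distrib_left:
  "ore_mult \<sigma> \<delta> p (q + s) = ore_mult \<sigma> \<delta> p q + ore_mult \<sigma> \<delta> p s"
  by (simp add: ore_mult_def times_X_pow_add scale_left_add sum.distrib)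

lemma ore_mult_distrib_right:
  "ore_mult \<sigma> \<delta> (p + q) s = ore_mult \<sigma> \<delta> p s + ore_mult \<sigma> \<delta> q s"
proof -
  define n where "n = max (degree p) (degree q)"
  have "degree (p + q) \<le> n" "degree p \<le> n" "degree q \<le> n"
    by (auto simp: n_def degree_add_le)
  then show ?thesis
    by (simp add: ore_mult_bound[of _ n] scale_left_add_left sum.distrib)
qed

lemma ore_mult_scale: "ore_mult \<sigma> \<delta> (scale_left c p) q = scale_left c (ore_mult \<sigma> \<delta> p q)"
proof -
  have "degree (scale_left c p) \<le> degree p"
    by (rule degree_le) (simp add: coeff_scale_left coeff_eq_0)
  then show ?thesis
    by (simp add: ore_mult_bound[of _ "degree p"] scale_left_sum coeff_scale_left)
qed

lemma ore_mult_times_X: "ore_mult \<sigma> \<delta> (times_X \<sigma> \<delta> p) q = times_X \<sigma> \<delta> (ore_mult \<sigma> \<delta> p q)"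
proof -
  let ?T = "\<lambda>i. (times_X \<sigma> \<delta> ^^ i) q" and ?n = "degree p"
  have "degree (times_X \<sigma> \<delta> p) \<le> Suc ?n"
    by (rule degree_le) (auto simp: coeff_times_X coeff_eq_0 sigma_delta split: nat.split)
  then have "ore_mult \<sigma> \<delta> (times_X \<sigma> \<delta> p) q =
      (\<Sum>i\<le>Suc ?n. scale_left (case i of 0 \<Rightarrow> 0 | Suc m \<Rightarrow> \<sigma> (coeff p m)) (?T i))
      + (\<Sum>i\<le>Suc ?n. scale_left (\<delta> (coeff p i)) (?T i))"
    by (simp only: ore_mult_bound[of _ "Suc ?n"] coeff_times_X scale_left_add_left sum.distrib)
  also have "\<dots> = (\<Sum>i\<le>?n. scale_left (\<sigma> (coeff p i)) (?T (Suc i)))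
      + (\<Sum>i\<le>?n. scale_left (\<delta> (coeff p i)) (?T i))"
    by (subst sum.atMost_Suc_shift) (simp add: coeff_eq_0 sigma_delta del: funpow.simps)
  also have "\<dots> = times_X \<sigma> \<delta> (ore_mult \<sigma> \<delta> p q)"
    by (simp add: ore_mult_def times_X_sum times_X_scale sum.distrib)
  finally show ?thesis .
qed

lemma ore_mult_times_X_pow:
  "ore_mult \<sigma> \<delta> ((times_X \<sigma> \<delta> ^^ i) p) q = (times_X \<sigma> \<delta> ^^ i) (ore_mult \<sigma> \<delta> p q)"
  by (induction i) (simp_all add: ore_mult_times_X)

lemma ore_mult_zero: "ore_mult \<sigma> \<delta> 0 q = 0"
  by (simp add: ore_mult_def)

lemma ore_mult_sum: "ore_mult \<sigma> \<delta> (\<Sum>i\<in>A. g i) q = (\<Sum>i\<in>A. ore_mult \<sigma> \<delta> (g i) q)"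
  by (induction A rule: infinite_finite_induct) (simp_all add: ore_mult_distrib_right ore_mult_zero)

lemma ore_mult_assoc:
  "ore_mult \<sigma> \<delta> (ore_mult \<sigma> \<delta> p q) s = ore_mult \<sigma> \<delta> p (ore_mult \<sigma> \<delta> q s)"
  by (simp add: ore_mult_def[of _ _ p] ore_mult_sum ore_mult_scale ore_mult_times_X_pow)

lemma ore_mult_one_left: "ore_mult \<sigma> \<delta> [:1:] q = q"
  by (simp add: ore_mult_def)

lemma times_X_pow_one: "(times_X \<sigma> \<delta> ^^ i) [:1:] = monom 1 i"
proof (induction i)
  case (Suc i)
  have "coeff (times_X \<sigma> \<delta> (monom 1 i)) n = coeff (monom 1 (Suc i)) n" for n
    by (cases n) (simp_all add: coeff_times_X sigma_delta)
  then have "times_X \<sigma> \<delta> (monom 1 i) = monom 1 (Suc i)"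
    by (rule poly_eqI)
  with Suc show ?case
    by simp
qed (simp add: monom_0)

lemma ore_mult_one_right: "ore_mult \<sigma> \<delta> p [:1:] = p"
proof -
  have "scale_left c (monom 1 i) = monom c i" for c :: 'a and i
    by (simp add: poly_eq_iff coeff_scale_left)
  then show ?thesis
    by (simp add: ore_mult_def times_X_pow_one poly_as_sum_of_monoms)
qed

lemma ring_ore_extension: "ring (ore_extension \<sigma> \<delta>)"
proof (rule ringI)
  show "abelian_group (ore_extension \<sigma> \<delta>)"
  proof (rule abelian_groupI)
    fix x assume "x \<in> carrier (ore_extension \<sigma> \<delta>)"
    show "\<exists>y\<in>carrier (ore_extension \<sigma> \<delta>). y \<oplus>\<^bsub>ore_extension \<sigma> \<delta>\<^esub> x = \<zero>\<^bsub>ore_extension \<sigma> \<delta>\<^esub>"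
      by (rule bexI[of _ "- x"]) (simp_all add: ore_extension_def)
  qed (simp_all add: ore_extension_def ac_simps)
  show "Group.monoid (ore_extension \<sigma> \<delta>)"
    by (rule monoidI)
      (simp_all add: ore_extension_def ore_mult_assoc ore_mult_one_left ore_mult_one_right)
qed (simp_all add: ore_extension_def ore_mult_distrib_left ore_mult_distrib_right)

lemma ore_X_commute:
  "ore_X \<otimes>\<^bsub>ore_extension \<sigma> \<delta>\<^esub> [:a:]
     = ([:\<sigma> a:] \<otimes>\<^bsub>ore_extension \<sigma> \<delta>\<^esub> ore_X) \<oplus>\<^bsub>ore_extension \<sigma> \<delta>\<^esub> [:\<delta> a:]"
proof -
  have "ore_mult \<sigma> \<delta> ore_X [:a:] = times_X \<sigma> \<delta> [:a:]"
    by (simp add: ore_mult_def ore_X_def)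
  moreover have "ore_mult \<sigma> \<delta> [:\<sigma> a:] ore_X = scale_left (\<sigma> a) ore_X"
    by (simp add: ore_mult_def)
  moreover have "times_X \<sigma> \<delta> [:a:] = scale_left (\<sigma> a) ore_X + [:\<delta> a:]"
    by (simp add: poly_eq_iff coeff_times_X coeff_scale_left ore_X_def coeff_pCons sigma_delta
        split: nat.split)
  ultimately show ?thesis
    by (simp add: ore_extension_def)
qed

end


section \<open>The center, polynomials in a central element, bounds\<close>

definition ring_center :: "('a, 'b) ring_scheme \<Rightarrow> 'a set" where
  "ring_center R = {c \<in> carrier R. \<forall>x \<in> carrier R. c \<otimes>\<^bsub>R\<^esub> x = x \<otimes>\<^bsub>R\<^esub> c}"

definition free_of_rank :: "('a, 'b) ring_scheme \<Rightarrow> 'a set \<Rightarrow> nat \<Rightarrow> bool" where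
  "free_of_rank R C r \<longleftrightarrow>
     (\<exists>B \<subseteq> carrier R. finite B \<and> card B = r \<and>
        (\<forall>x \<in> carrier R. \<exists>!c. c \<in> B \<rightarrow>\<^sub>E C \<and> x = (\<Oplus>\<^bsub>R\<^esub>b\<in>B. c b \<otimes>\<^bsub>R\<^esub> b)))"

definition central_subfield :: "'a::division_ring set \<Rightarrow> bool" where
  "central_subfield K \<longleftrightarrow>
     0 \<in> K \<and> 1 \<in> K \<and> (\<forall>a\<in>K. \<forall>b\<in>K. a + b \<in> K \<and> a * b \<in> K) \<and> (\<forall>a\<in>K. - a \<in> K \<and> inverse a \<in> K) \<and>
     (\<forall>a\<in>K. \<forall>d. a * d = d * a)"

text \<open>The subset \<open>K[z]\<close> of \<open>R\<close>, for a set \<open>K\<close> of constants.\<close>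

definition adjoin :: "('a::zero poly, 'b) ring_scheme \<Rightarrow> 'a set \<Rightarrow> 'a poly \<Rightarrow> 'a poly set" where
  "adjoin R K z = {(\<Oplus>\<^bsub>R\<^esub>i\<in>{..n}. [:k i:] \<otimes>\<^bsub>R\<^esub> (z [^]\<^bsub>R\<^esub> i)) | (n::nat) k. \<forall>i. k i \<in> K}"

text \<open>\<open>PIdl\<^bsub>R\<^esub> a\<close> of the library is the left ideal \<open>R a\<close>, also when \<open>R\<close> is not commutative.\<close>

definition twosided :: "('a, 'b) ring_scheme \<Rightarrow> 'a \<Rightarrow> bool" where
  "twosided R a \<longleftrightarrow> PIdl\<^bsub>R\<^esub> a = a <#\<^bsub>R\<^esub> carrier R"

text \<open>\<open>Ann\<^sub>R(R/Rf)\<close>: here \<open>a (x + Rf) = 0\<close> is written as \<open>a x \<in> Rf\<close>.\<close>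

definition ann_quotient :: "('a, 'b) ring_scheme \<Rightarrow> 'a \<Rightarrow> 'a set" where
  "ann_quotient R f = {a \<in> carrier R. \<forall>x \<in> carrier R. a \<otimes>\<^bsub>R\<^esub> x \<in> PIdl\<^bsub>R\<^esub> f}"

text \<open>
  A bound is determined only up to left multiplication by a nonzero constant, hence a relation;
  \<open>f\<^sup>* = h\<^sup>*\<close> means that \<open>f\<close> and \<open>h\<close> have a common bound.
\<close>

definition is_bound :: "('a, 'b) ring_scheme \<Rightarrow> 'a \<Rightarrow> 'a \<Rightarrow> bool" where
  "is_bound R f g \<longleftrightarrow> g \<in> carrier R \<and> twosided R g \<and> PIdl\<^bsub>R\<^esub> g = ann_quotient R f"

definition proper_factorization :: "('a, 'b) ring_scheme \<Rightarrow> 'a \<Rightarrow> 'a \<Rightarrow> 'a \<Rightarrow> bool" where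
  "proper_factorization R f g h \<longleftrightarrow>
     g \<in> carrier R \<and> h \<in> carrier R \<and> f = g \<otimes>\<^bsub>R\<^esub> h \<and> g \<notin> Units R \<and> h \<notin> Units R"

definition reducible :: "('a, 'b) ring_scheme \<Rightarrow> 'a \<Rightarrow> bool" where
  "reducible R f \<longleftrightarrow> (\<exists>g h. proper_factorization R f g h)"


section \<open>Zero divisors in corner algebras\<close>

definition zero_divisor :: "('a, 'b) ring_scheme \<Rightarrow> 'a \<Rightarrow> bool" where
  "zero_divisor B x \<longleftrightarrow> x \<in> carrier B \<and> x \<noteq> \<zero>\<^bsub>B\<^esub> \<and>
     (\<exists>y \<in> carrier B. y \<noteq> \<zero>\<^bsub>B\<^esub> \<and> (x \<otimes>\<^bsub>B\<^esub> y = \<zero>\<^bsub>B\<^esub> \<or> y \<otimes>\<^bsub>B\<^esub> x = \<zero>\<^bsub>B\<^esub>))"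

text \<open>
  The corner \<open>u A u\<close> of \<open>A = R/I\<close> at an idempotent \<open>u\<close>. If \<open>S\<close> is a central subring of \<open>R\<close> and
  \<open>J \<subseteq> I\<close> an ideal of \<open>S\<close>, the scalar \<open>\<kappa> = s + J \<in> S/J\<close> acts as multiplication by \<open>\<kappa> + I = s + I \<in> A\<close>.
\<close>

definition corner_algebra ::
  "('a, 'b) ring_scheme \<Rightarrow> 'a set \<Rightarrow> 'a set \<Rightarrow> ('a set, 'a set) module" where
  "corner_algebra R I u =
     \<lparr>carrier = {u \<otimes>\<^bsub>R Quot I\<^esub> x \<otimes>\<^bsub>R Quot I\<^esub> u | x. x \<in> carrier (R Quot I)},
      mult = (\<otimes>\<^bsub>R Quot I\<^esub>), one = u, zero = \<zero>\<^bsub>R Quot I\<^esub>, add = (\<oplus>\<^bsub>R Quot I\<^esub>),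
      smult = (\<lambda>\<kappa> x. (\<kappa> <+>\<^bsub>R\<^esub> I) \<otimes>\<^bsub>R Quot I\<^esub> x)\<rparr>"

text \<open>The library locale \<open>algebra\<close> is restricted to commutative algebras.\<close>

definition assoc_algebra :: "('k, 'c) ring_scheme \<Rightarrow> ('k, 'a, 'b) module_scheme \<Rightarrow> bool" where
  "assoc_algebra F B \<longleftrightarrow> ring B \<and> module F B \<and>
     (\<forall>k \<in> carrier F. \<forall>x \<in> carrier B. \<forall>y \<in> carrier B.
        (k \<odot>\<^bsub>B\<^esub> x) \<otimes>\<^bsub>B\<^esub> y = k \<odot>\<^bsub>B\<^esub> (x \<otimes>\<^bsub>B\<^esub> y) \<and> x \<otimes>\<^bsub>B\<^esub> (k \<odot>\<^bsub>B\<^esub> y) = k \<odot>\<^bsub>B\<^esub> (x \<otimes>\<^bsub>B\<^esub> y))"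


section \<open>Euclidean algorithm\<close>

text \<open>
  These are programs over the arithmetic of \<open>D\<close>, \<open>\<sigma>\<close>, \<open>\<delta>\<close>. Right division of \<open>r\<close> by \<open>q \<noteq> 0\<close>:
  as \<open>c X\<^sup>n q\<close> has leading coefficient \<open>c \<sigma>\<^sup>n(lc q)\<close>, the leading term of \<open>r\<close> is cancelled by
  subtracting \<open>t q\<close> with \<open>t = (lc r / \<sigma>\<^sup>n(lc q)) X\<^sup>n\<close>. Started with \<open>u = 0\<close>, the result is the pair
  of quotient and remainder, \<open>r = u q + s\<close> with \<open>s = 0\<close> or \<open>degree s < degree q\<close>.
\<close>

partial_function (tailrec) ore_divmod ::
  "('a::division_ring \<Rightarrow> 'a) \<Rightarrow> ('a \<Rightarrow> 'a) \<Rightarrow> 'a poly \<Rightarrow> 'a poly \<Rightarrow> 'a poly \<Rightarrow> 'a poly \<times> 'a poly"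
where
  "ore_divmod \<sigma> \<delta> q u r =
     (if r = 0 \<or> degree r < degree q then (u, r)
      else let n = degree r - degree q;
               t = monom (lead_coeff r / (\<sigma> ^^ n) (lead_coeff q)) n
           in ore_divmod \<sigma> \<delta> q (u + t) (r - ore_mult \<sigma> \<delta> t q))"

definition ore_quot ::
  "('a::division_ring \<Rightarrow> 'a) \<Rightarrow> ('a \<Rightarrow> 'a) \<Rightarrow> 'a poly \<Rightarrow> 'a poly \<Rightarrow> 'a poly" where
  "ore_quot \<sigma> \<delta> p q = fst (ore_divmod \<sigma> \<delta> q 0 p)"

definition ore_rem ::
  "('a::division_ring \<Rightarrow> 'a) \<Rightarrow> ('a \<Rightarrow> 'a) \<Rightarrow> 'a poly \<Rightarrow> 'a poly \<Rightarrow> 'a poly" where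
  "ore_rem \<sigma> \<delta> p q = snd (ore_divmod \<sigma> \<delta> q 0 p)"

text \<open>Greatest common right divisor: a generator of the left ideal \<open>R p + R q\<close>.\<close>

partial_function (tailrec) ore_gcrd ::
  "('a::division_ring \<Rightarrow> 'a) \<Rightarrow> ('a \<Rightarrow> 'a) \<Rightarrow> 'a poly \<Rightarrow> 'a poly \<Rightarrow> 'a poly"
where
  "ore_gcrd \<sigma> \<delta> p q = (if q = 0 then p else ore_gcrd \<sigma> \<delta> q (ore_rem \<sigma> \<delta> p q))"

text \<open>
  The factorization computed from a zero divisor \<open>g + Rf\<^sup>*\<close>, given by any representative \<open>g\<close>:
  \<open>h\<close> generates \<open>R f + R g\<close>.
\<close>

definition zero_divisor_factors ::
  "('a::division_ring \<Rightarrow> 'a) \<Rightarrow> ('a \<Rightarrow> 'a) \<Rightarrow> 'a poly \<Rightarrow> 'a poly \<Rightarrow> 'a poly \<times> 'a poly" where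
  "zero_divisor_factors \<sigma> \<delta> f g =
     (let h = ore_gcrd \<sigma> \<delta> f g in (ore_quot \<sigma> \<delta> f h, h))"

end

theory Submission
  imports Defs "HOL-Algebra.Subrings"
begin

text \<open>
  Put \<open>u = 1 - e\<close>, so that \<open>R/Rf\<close> is isomorphic to \<open>Au\<close> with endomorphism ring \<open>uAu\<close>. If \<open>x = g + I\<close>
  is a zero divisor of \<open>uAu\<close> and \<open>Rh = Rf + Rg\<close>, then \<open>Rh = R\<close> would make \<open>x\<close> left invertible in the
  corner, which is Dedekind finite by the ascending chain condition, and \<open>Rh = Rf\<close> would give
  \<open>x \<in> Ae\<close>, hence \<open>x = 0\<close>. Conversely, let \<open>f = gh\<close> be proper, so that \<open>0 \<noteq> Ahu \<noteq> Au\<close>. Without zero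
  divisors \<open>uAu\<close> is a division ring by the descending chain condition, and \<open>uAhu \<noteq> 0\<close> then
  forces \<open>Ahu = Au\<close>.

  \<open>A\<close> need not be simple: twosided ideals \<open>RX\<^sup>m\<close> may lie strictly between \<open>I\<close> and \<open>R\<close>. The inequality
  \<open>uAhu \<noteq> 0\<close> holds nevertheless, because such ideals are nilpotent modulo \<open>I\<close> and therefore do not
  contain \<open>u\<close>.
\<close>

section \<open>Ring laws of the Ore extension in polynomial notation\<close>

locale skew_polynomials =
  fixes \<sigma> \<delta> :: "'a::division_ring \<Rightarrow> 'a"
  assumes aut: "skew_automorphism \<sigma>" and der: "skew_derivation \<sigma> \<delta>"
begin

abbreviation mult (infixl \<open>\<star>\<close> 70)
  where "p \<star> q \<equiv> ore_mult \<sigma> \<delta> p q"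

lemmas mult_assoc = ore_mult_assoc[OF aut der]
  and distrib_left = ore_mult_distrib_left[OF aut der]
  and distrib_right = ore_mult_distrib_right[OF aut der]
  and mult_one_left [simp] = ore_mult_one_left[OF aut der]
  and mult_one_right [simp] = ore_mult_one_right[OF aut der]
  and mult_zero_left [simp] = ore_mult_zero[OF aut der]

lemma mult_zero_right [simp]: "p \<star> 0 = 0"
  using distrib_left[of p 0 0] by simp

lemma mult_minus_left: "(- p) \<star> q = - (p \<star> q)"
  using distrib_right[of "- p" p q] by (simp add: eq_neg_iff_add_eq_0)

lemma mult_minus_right: "p \<star> (- q) = - (p \<star> q)"
  using distrib_left[of p "- q" q] by (simp add: eq_neg_iff_add_eq_0)

lemma diff_distrib_left: "p \<star> (q - s) = p \<star> q - p \<star> s"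
  using distrib_left[of p q "- s"] by (simp add: mult_minus_right)

lemma diff_distrib_right: "(p - q) \<star> s = p \<star> s - q \<star> s"
  using distrib_right[of p "- q" s] by (simp add: mult_minus_left)

lemmas mult_simps = mult_assoc distrib_left distrib_right diff_distrib_left diff_distrib_right
  mult_minus_left mult_minus_right

section \<open>Degrees\<close>

lemma bij_sigma_pow: "bij (\<sigma> ^^ i)"
  using aut by (simp add: skew_automorphism_def bij_betw_funpow)

lemma sigma_pow_0 [simp]: "(\<sigma> ^^ i) 0 = 0"
  by (induction i) (simp_all add: sigma_delta[OF aut der])

lemma sigma_pow_eq_0_iff [simp]: "(\<sigma> ^^ i) c = 0 \<longleftrightarrow> c = 0"
  using bij_sigma_pow[of i] sigma_pow_0[of i] by (metis bij_pointE)

text \<open>Each multiplication by \<open>X\<close> shifts the top coefficient up by one place and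
  applies \<sigma> to it; the \<delta> part stays within the old degree bound.\<close>

lemma coeff_times_X_pow_top:
  assumes "degree q \<le> n"
  shows "degree ((times_X \<sigma> \<delta> ^^ i) q) \<le> n + i"
    and "coeff ((times_X \<sigma> \<delta> ^^ i) q) (n + i) = (\<sigma> ^^ i) (coeff q n)"
proof -
  have "degree ((times_X \<sigma> \<delta> ^^ i) q) \<le> n + i \<and>
    coeff ((times_X \<sigma> \<delta> ^^ i) q) (n + i) = (\<sigma> ^^ i) (coeff q n)"
  proof (induction i)
    case 0
    then show ?case using assms by simp
  next
    case (Suc i)
    have "degree ((times_X \<sigma> \<delta> ^^ Suc i) q) \<le> n + Suc i"
      using Suc
      by (intro degree_le)
        (auto simp: coeff_times_X[OF aut der] coeff_eq_0 sigma_delta[OF aut der] split: nat.split)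
    with Suc show ?case
      by (simp add: coeff_times_X[OF aut der] coeff_eq_0 sigma_delta[OF aut der])
  qed
  then show "degree ((times_X \<sigma> \<delta> ^^ i) q) \<le> n + i"
    and "coeff ((times_X \<sigma> \<delta> ^^ i) q) (n + i) = (\<sigma> ^^ i) (coeff q n)"
    by simp_all
qed

lemma degree_mult_le: "degree (p \<star> q) \<le> degree p + degree q"
proof (rule degree_le, intro allI impI)
  fix k assume k: "degree p + degree q < k"
  have "coeff ((times_X \<sigma> \<delta> ^^ i) q) k = 0" if "i \<le> degree p" for i
    using coeff_times_X_pow_top(1)[of q "degree q" i] that k by (intro coeff_eq_0) simp
  then show "coeff (p \<star> q) k = 0"
    by (simp add: ore_mult_def coeff_sum coeff_scale_left)
qed

text \<open>In the sum that defines the product, only the term of index \<open>degree p\<close>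
  reaches this degree.\<close>

lemma coeff_mult_top:
  "coeff (p \<star> q) (degree p + degree q) = lead_coeff p * (\<sigma> ^^ degree p) (lead_coeff q)"
proof -
  let ?c = "\<lambda>i. coeff p i * coeff ((times_X \<sigma> \<delta> ^^ i) q) (degree p + degree q)"
  have "coeff (p \<star> q) (degree p + degree q) = (\<Sum>i\<le>degree p. ?c i)"
    by (simp add: ore_mult_def coeff_sum coeff_scale_left)
  also have "\<dots> = (\<Sum>i\<in>{degree p}. ?c i)"
  proof (rule sum.mono_neutral_right)
    show "\<forall>i\<in>{..degree p} - {degree p}. ?c i = 0"
    proof
      fix i assume "i \<in> {..degree p} - {degree p}"
      then have "degree ((times_X \<sigma> \<delta> ^^ i) q) < degree p + degree q"
        using coeff_times_X_pow_top(1)[of q "degree q" i] by auto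
      then show "?c i = 0" by (simp add: coeff_eq_0)
    qed
  qed auto
  also have "\<dots> = lead_coeff p * (\<sigma> ^^ degree p) (lead_coeff q)"
    using coeff_times_X_pow_top(2)[of q "degree q" "degree p"] by (simp add: add.commute)
  finally show ?thesis .
qed

text \<open>Powers of \<sigma> are injective and \<open>D\<close> is a skew field, so the top
  coefficient of the product does not vanish. Hence \<open>R\<close> is a domain with additive
  degree.\<close>

lemma degree_mult:
  assumes "p \<noteq> 0" "q \<noteq> 0"
  shows "degree (p \<star> q) = degree p + degree q" "p \<star> q \<noteq> 0"
proof -
  have "coeff (p \<star> q) (degree p + degree q) \<noteq> 0"
    using assms by (simp add: coeff_mult_top)
  then show "degree (p \<star> q) = degree p + degree q" "p \<star> q \<noteq> 0"
    using degree_mult_le[of p q] by (auto intro: antisym le_degree)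
qed

lemma lead_coeff_mult:
  assumes "p \<noteq> 0" "q \<noteq> 0"
  shows "lead_coeff (p \<star> q) = lead_coeff p * (\<sigma> ^^ degree p) (lead_coeff q)"
  using degree_mult(1)[OF assms] coeff_mult_top by simp

lemma mult_right_cancel: "q \<noteq> 0 \<Longrightarrow> p \<star> q = s \<star> q \<Longrightarrow> p = s"
  using degree_mult(2)[of "p - s" q] by (auto simp: diff_distrib_right)

lemma const_mult: "[:c:] \<star> p = scale_left c p"
  by (simp add: ore_mult_def)

lemma const_mult_const: "[:c:] \<star> [:d:] = [:c * d:]"
  by (simp add: const_mult poly_eq_iff coeff_scale_left coeff_pCons split: nat.split)

lemma degree_0_inverse:
  assumes "degree p = 0" "p \<noteq> 0"
  obtains q where "p \<star> q = [:1:]" "q \<star> p = [:1:]" "q \<noteq> 0" "degree q = 0"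
proof -
  obtain c where c: "p = [:c:]" "c \<noteq> 0"
    using assms by (metis degree_eq_zeroE pCons_0_0)
  show ?thesis
    by (rule that[of "[:inverse c:]"]) (simp_all add: c const_mult_const)
qed

lemma mult_monom: "monom 1 m \<star> monom 1 n = monom 1 (m + n)"
proof -
  have "monom 1 m \<star> monom 1 n = (times_X \<sigma> \<delta> ^^ m) (monom 1 n)"
    using times_X_pow_one[OF aut der, of m] ore_mult_times_X_pow[OF aut der, of m "[:1:]" "monom 1 n"]
    by simp
  also have "\<dots> = (times_X \<sigma> \<delta> ^^ (m + n)) [:1:]"
    by (simp only: funpow_add comp_apply times_X_pow_one[OF aut der])
  finally show ?thesis
    by (simp only: times_X_pow_one[OF aut der])
qed

lemma degree_diff_less:
  assumes "degree (q :: 'a poly) = degree p" "lead_coeff q = lead_coeff p" "p - q \<noteq> 0"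
  shows "degree (p - q) < degree p"
proof -
  have "degree (p - q) \<le> degree p"
    using assms(1) by (simp add: degree_diff_le)
  moreover have "coeff (p - q) (degree p) = 0"
    using assms(1,2) by simp
  ultimately show ?thesis
    using assms(3) by (metis le_neq_implies_less leading_coeff_neq_0)
qed

section \<open>Division and greatest common right divisors\<close>

text \<open>Each recursive call moves a multiple \<open>t \<star> q\<close> from the second summand
  to the first, so \<open>u \<star> q + r\<close> is invariant; the leading terms of
  \<open>r\<close> and \<open>t \<star> q\<close> cancel, which gives termination.\<close>

lemma ore_divmod_correct:
  assumes "q \<noteq> 0" "ore_divmod \<sigma> \<delta> q u r = (u', s)"
  shows "u \<star> q + r = u' \<star> q + s" "s = 0 \<or> degree s < degree q"
proof -
  have "u \<star> q + r = u' \<star> q + s \<and> (s = 0 \<or> degree s < degree q)"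
    using assms(2)
  \<comment> \<open>The measure puts the zero polynomial strictly below the nonzero constants, from
    which \<open>degree\<close> cannot separate it.\<close>
  proof (induction "if r = 0 then 0 else Suc (degree r)" arbitrary: u r rule: less_induct)
    case less
    show ?case
    proof (cases "r = 0 \<or> degree r < degree q")
      case True
      then show ?thesis
        using less.prems by (subst (asm) ore_divmod.simps) auto
    next
      case False
      define n where "n = degree r - degree q"
      define t where "t = monom (lead_coeff r / (\<sigma> ^^ n) (lead_coeff q)) n"
      have t: "t \<noteq> 0" "degree t = n" "lead_coeff t = lead_coeff r / (\<sigma> ^^ n) (lead_coeff q)"
        using False assms(1) by (simp_all add: t_def degree_monom_eq divide_inverse)
      have tq: "degree (t \<star> q) = degree r" "lead_coeff (t \<star> q) = lead_coeff r"
        using lead_coeff_mult[OF t(1) assms(1)] degree_mult[OF t(1) assms(1)] t(2,3) False assms(1)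
        by (simp_all add: n_def divide_inverse mult.assoc)
      have "ore_divmod \<sigma> \<delta> q u r = ore_divmod \<sigma> \<delta> q (u + t) (r - t \<star> q)"
        unfolding ore_divmod.simps[of \<sigma> \<delta> q u r] Let_def t_def n_def by (rule if_not_P[OF False])
      then have "ore_divmod \<sigma> \<delta> q (u + t) (r - t \<star> q) = (u', s)"
        using less.prems by simp
      moreover have "r - t \<star> q = 0 \<or> degree (r - t \<star> q) < degree r"
        using degree_diff_less[OF tq] by blast
      ultimately have "(u + t) \<star> q + (r - t \<star> q) = u' \<star> q + s \<and> (s = 0 \<or> degree s < degree q)"
        using False by (intro less.hyps) auto
      then show ?thesis
        by (simp add: distrib_right)
    qed
  qed
  then show "u \<star> q + r = u' \<star> q + s" "s = 0 \<or> degree s < degree q"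
    by simp_all
qed

lemma ore_quot_rem:
  assumes "q \<noteq> 0"
  shows "p = ore_quot \<sigma> \<delta> p q \<star> q + ore_rem \<sigma> \<delta> p q"
    and "ore_rem \<sigma> \<delta> p q = 0 \<or> degree (ore_rem \<sigma> \<delta> p q) < degree q"
  using ore_divmod_correct[OF assms, of 0 p "ore_quot \<sigma> \<delta> p q" "ore_rem \<sigma> \<delta> p q"]
  by (simp_all add: ore_quot_def ore_rem_def)

text \<open>With the quotient on the right, its leading coefficient enters through a power of
  \<sigma>, so cancelling the leading term needs a preimage under that power. Here the surjectivity
  of \<sigma> is used.\<close>

lemma left_division:
  assumes "q \<noteq> 0"
  obtains u s where "p = q \<star> u + s" "s = 0 \<or> degree s < degree q"
proof -
  have "\<exists>u s. p = q \<star> u + s \<and> (s = 0 \<or> degree s < degree q)"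
  proof (induction "if p = 0 then 0 else Suc (degree p)" arbitrary: p rule: less_induct)
    case less
    show ?case
    proof (cases "p = 0 \<or> degree p < degree q")
      case True
      then show ?thesis
        by (intro exI[of _ 0] exI[of _ p]) simp
    next
      case False
      define n where "n = degree p - degree q"
      obtain c where c: "(\<sigma> ^^ degree q) c = inverse (lead_coeff q) * lead_coeff p"
        using bij_sigma_pow[of "degree q"] by (metis bij_pointE)
      define t where "t = monom c n"
      have "c \<noteq> 0"
        using c False assms by (metis sigma_pow_0 inverse_nonzero_iff_nonzero leading_coeff_0_iff
            no_zero_divisors)
      then have t: "t \<noteq> 0" "degree t = n" "lead_coeff t = c"
        by (simp_all add: t_def degree_monom_eq)
      have tq: "degree (q \<star> t) = degree p" "lead_coeff (q \<star> t) = lead_coeff p"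
        using lead_coeff_mult[OF assms t(1)] degree_mult[OF assms t(1)] t(2,3) False assms
        by (simp_all add: n_def c mult.assoc[symmetric])
      have "p - q \<star> t = 0 \<or> degree (p - q \<star> t) < degree p"
        using degree_diff_less[OF tq] by blast
      then have "\<exists>u s. p - q \<star> t = q \<star> u + s \<and> (s = 0 \<or> degree s < degree q)"
        using False by (intro less.hyps) auto
      then obtain u s where "p - q \<star> t = q \<star> u + s" "s = 0 \<or> degree s < degree q"
        by blast
      then have "p = q \<star> (u + t) + s" "s = 0 \<or> degree s < degree q"
        by (auto simp: distrib_left algebra_simps)
      then show ?thesis by blast
    qed
  qed
  then show ?thesis using that by blast
qed

text \<open>Together the three claims say that the result generates \<open>R p + R q\<close>. Since
  \<open>p = u \<star> q + s\<close>, one Euclidean step replaces \<open>p, q\<close> by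
  \<open>q, s\<close> without changing this left ideal.\<close>

lemma ore_gcrd_correct:
  "\<exists>a b. ore_gcrd \<sigma> \<delta> p q = a \<star> p + b \<star> q"
  "\<exists>c. p = c \<star> ore_gcrd \<sigma> \<delta> p q"
  "\<exists>d. q = d \<star> ore_gcrd \<sigma> \<delta> p q"
proof -
  have "(\<exists>a b. ore_gcrd \<sigma> \<delta> p q = a \<star> p + b \<star> q) \<and> (\<exists>c. p = c \<star> ore_gcrd \<sigma> \<delta> p q) \<and>
    (\<exists>d. q = d \<star> ore_gcrd \<sigma> \<delta> p q)"
  proof (induction "if q = 0 then 0 else Suc (degree q)" arbitrary: p q rule: less_induct)
    case less
    show ?case
    proof (cases "q = 0")
      case True
      then have "ore_gcrd \<sigma> \<delta> p q = p"
        by (subst ore_gcrd.simps) simp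
      moreover have "p = [:1:] \<star> p + 0 \<star> q" "p = [:1:] \<star> p" "q = 0 \<star> p"
        using True by simp_all
      ultimately show ?thesis
        by metis
    next
      case False
      define s where "s = ore_rem \<sigma> \<delta> p q"
      define u where "u = ore_quot \<sigma> \<delta> p q"
      define h where "h = ore_gcrd \<sigma> \<delta> q s"
      have p: "p = u \<star> q + s" and "s = 0 \<or> degree s < degree q"
        unfolding s_def u_def by (rule ore_quot_rem[OF False])+
      then have "(\<exists>a b. h = a \<star> q + b \<star> s) \<and> (\<exists>c. q = c \<star> h) \<and> (\<exists>d. s = d \<star> h)"
        unfolding h_def using False by (intro less.hyps) auto
      then obtain a b c d where h: "h = a \<star> q + b \<star> s" "q = c \<star> h" "s = d \<star> h"
        by blast
      have "ore_gcrd \<sigma> \<delta> p q = h"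
        using False by (subst ore_gcrd.simps) (simp add: h_def s_def)
      moreover have "h = b \<star> p + (a - b \<star> u) \<star> q"
        using h(1) p by (simp add: mult_simps)
      moreover have "p = (u \<star> c + d) \<star> h"
        using p h(2,3) by (metis distrib_right mult_assoc)
      ultimately show ?thesis
        using h(2) by metis
    qed
  qed
  then show "\<exists>a b. ore_gcrd \<sigma> \<delta> p q = a \<star> p + b \<star> q" "\<exists>c. p = c \<star> ore_gcrd \<sigma> \<delta> p q"
    "\<exists>d. q = d \<star> ore_gcrd \<sigma> \<delta> p q"
    by blast+
qed

section \<open>Left ideals\<close>

text \<open>Closure under negation comes from multiplication by \<open>- [:1:]\<close>.\<close>

definition left_ideal :: "'a poly set \<Rightarrow> bool" where
  "left_ideal L \<longleftrightarrow> 0 \<in> L \<and> (\<forall>p\<in>L. \<forall>q\<in>L. p + q \<in> L) \<and> (\<forall>p. \<forall>q\<in>L. p \<star> q \<in> L)"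

abbreviation left_multiples :: "'a poly \<Rightarrow> 'a poly set" where
  "left_multiples t \<equiv> range (\<lambda>p. p \<star> t)"

lemma left_multiplesI: "p \<star> t \<in> left_multiples t"
  by (rule rangeI)

lemma left_idealD:
  assumes "left_ideal L"
  shows "0 \<in> L" "p \<in> L \<Longrightarrow> q \<in> L \<Longrightarrow> p + q \<in> L" "q \<in> L \<Longrightarrow> p \<star> q \<in> L"
    "q \<in> L \<Longrightarrow> - q \<in> L" "p \<in> L \<Longrightarrow> q \<in> L \<Longrightarrow> p - q \<in> L"
proof -
  show *: "0 \<in> L" "p \<in> L \<Longrightarrow> q \<in> L \<Longrightarrow> p + q \<in> L" "q \<in> L \<Longrightarrow> p \<star> q \<in> L" for p q
    using assms by (simp_all add: left_ideal_def)
  show neg: "- q \<in> L" if "q \<in> L" for q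
    using *(3)[OF that, of "- [:1:]"] by (simp only: mult_minus_left mult_one_left)
  show "p - q \<in> L" if "p \<in> L" "q \<in> L"
    using *(2)[OF that(1) neg[OF that(2)]] by simp
qed

lemma left_ideal_left_multiples: "left_ideal (left_multiples t)"
  unfolding left_ideal_def
proof (intro conjI ballI allI)
  show "0 \<in> left_multiples t"
    by (metis mult_zero_left rangeI)
  show "p + q \<in> left_multiples t" if "p \<in> left_multiples t" "q \<in> left_multiples t" for p q
    using that by (auto simp: distrib_right[symmetric])
  show "p \<star> q \<in> left_multiples t" if "q \<in> left_multiples t" for p q
    using that by (auto simp: mult_assoc[symmetric])
qed

text \<open>The remainder of an element of \<open>L\<close> on division by \<open>t\<close> lies in
  \<open>L\<close> again, and a nonzero one would have smaller degree than \<open>t\<close>.\<close>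

lemma left_ideal_eq_left_multiples:
  assumes "left_ideal L" "t \<in> L" "t \<noteq> 0" "\<And>p. p \<in> L \<Longrightarrow> p \<noteq> 0 \<Longrightarrow> degree t \<le> degree p"
  shows "L = left_multiples t"
proof
  show "L \<subseteq> left_multiples t"
  proof
    fix p assume p: "p \<in> L"
    have "ore_rem \<sigma> \<delta> p t = p - ore_quot \<sigma> \<delta> p t \<star> t"
      using ore_quot_rem(1)[OF assms(3), of p] by (simp add: algebra_simps)
    also have "\<dots> \<in> L"
      using p assms(1,2) by (intro left_idealD) auto
    finally have "ore_rem \<sigma> \<delta> p t \<in> L" .
    then have "ore_rem \<sigma> \<delta> p t = 0"
      using ore_quot_rem(2)[OF assms(3), of p] assms(4) by fastforce
    then show "p \<in> left_multiples t"
      using ore_quot_rem(1)[OF assms(3), of p] by (metis add.right_neutral rangeI)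
  qed
  show "left_multiples t \<subseteq> L"
    using left_idealD(3)[OF assms(1)] assms(2) by auto
qed

text \<open>For a left ideal this is the degree of a generator. The value is meaningful only if
  \<open>L\<close> contains a nonzero element, and all uses supply one.\<close>

definition min_degree :: "'a poly set \<Rightarrow> nat" where
  "min_degree L = (LEAST n. \<exists>p\<in>L. p \<noteq> 0 \<and> degree p = n)"

lemma min_degree_le: "p \<in> L \<Longrightarrow> p \<noteq> 0 \<Longrightarrow> min_degree L \<le> degree p"
  unfolding min_degree_def by (rule Least_le) auto

lemma min_degree_attained:
  assumes "p \<in> L" "p \<noteq> 0"
  obtains t where "t \<in> L" "t \<noteq> 0" "degree t = min_degree L"
  using LeastI[of "\<lambda>n. \<exists>p\<in>L. p \<noteq> 0 \<and> degree p = n" "degree p"] assms that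
  unfolding min_degree_def by blast

text \<open>Otherwise an element of \<open>L\<close> of minimal degree is also minimal in
  \<open>M\<close>, hence generates \<open>M\<close>, and the two ideals coincide.\<close>

lemma min_degree_strict_mono:
  assumes "left_ideal L" "left_ideal M" "L \<subset> M" "p \<in> L" "p \<noteq> 0"
  shows "min_degree M < min_degree L"
proof (rule ccontr)
  assume "\<not> min_degree M < min_degree L"
  moreover obtain t where t: "t \<in> L" "t \<noteq> 0" "degree t = min_degree L"
    using min_degree_attained[OF assms(4,5)] .
  ultimately have "degree t \<le> degree q" if "q \<in> M" "q \<noteq> 0" for q
    using min_degree_le[OF that] by simp
  then have "M = left_multiples t"
    using t assms by (intro left_ideal_eq_left_multiples) auto
  then show False
    using assms(1,3) t(1) left_idealD(3) by blast
qed

text \<open>Strict inclusions lower the minimal degree, which cannot drop forever.\<close>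

lemma ascending_chain:
  assumes "\<And>n. left_ideal (L n)" "\<And>n. L n \<subseteq> L (Suc n)" "p \<in> L 0" "p \<noteq> 0"
  obtains n where "L (Suc n) = L n"
proof -
  have p: "p \<in> L n" for n
    using assms(2,3) by (induction n) auto
  have False if "\<And>n. L (Suc n) \<noteq> L n"
  proof -
    have "min_degree (L n) + n \<le> min_degree (L 0)" for n
    proof (induction n)
      case (Suc n)
      have "min_degree (L (Suc n)) < min_degree (L n)"
        using min_degree_strict_mono[OF assms(1,1) _ p assms(4)] assms(2) that by blast
      with Suc show ?case by simp
    qed simp
    from this[of "Suc (min_degree (L 0))"] show False by simp
  qed
  then show ?thesis using that by blast
qed

text \<open>\<open>R\<close> itself is not Artinian, as the left ideals \<open>R X^n\<close> show. A
  common nonzero element \<open>p\<close> bounds all minimal degrees by \<open>degree p\<close>,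
  whereas strict inclusions would raise them without limit. This is the Artinian property of
  quotients by nonzero ideals.\<close>

lemma descending_chain:
  assumes "\<And>n. left_ideal (L n)" "\<And>n. L (Suc n) \<subseteq> L n" "\<And>n. p \<in> L n" "p \<noteq> 0"
  obtains n where "L (Suc n) = L n"
proof -
  have False if "\<And>n. L (Suc n) \<noteq> L n"
  proof -
    have "n \<le> min_degree (L n)" for n
    proof (induction n)
      case (Suc n)
      have "min_degree (L n) < min_degree (L (Suc n))"
        using min_degree_strict_mono[OF assms(1,1) _ assms(3,4)] assms(2) that by blast
      with Suc show ?case by simp
    qed simp
    from this[of "Suc (degree p)"] min_degree_le[OF assms(3,4)] show False
      by (meson Suc_n_not_le_n le_trans)
  qed
  then show ?thesis using that by blast
qed

text \<open>Both divisions apply to a twosided ideal, so an element of minimal degree generates it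
  from either side.\<close>

lemma twosided_ideal_eq_multiples:
  assumes "left_ideal N" "\<And>p q. p \<in> N \<Longrightarrow> p \<star> q \<in> N"
    and "t \<in> N" "t \<noteq> 0" "\<And>p. p \<in> N \<Longrightarrow> p \<noteq> 0 \<Longrightarrow> degree t \<le> degree p"
  shows "N = left_multiples t" "N = range ((\<star>) t)"
proof -
  show "N = left_multiples t"
    by (rule left_ideal_eq_left_multiples) (use assms in auto)
  have "p \<in> range ((\<star>) t)" if p: "p \<in> N" for p
  proof -
    obtain u s where us: "p = t \<star> u + s" "s = 0 \<or> degree s < degree t"
      using left_division[OF assms(4)] .
    have "s = p - t \<star> u"
      using us(1) by simp
    then have "s \<in> N"
      using p assms(1-3) left_idealD(5) by simp
    then have "s = 0"
      using us(2) assms(5) by fastforce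
    then show ?thesis
      using us(1) by simp
  qed
  then show "N = range ((\<star>) t)"
    using assms(2,3) by blast
qed

section \<open>Twosided ideals over a central irreducible element\<close>

definition central :: "'a poly \<Rightarrow> bool" where
  "central p \<longleftrightarrow> (\<forall>q. p \<star> q = q \<star> p)"

end

text \<open>Here \<open>b\<close> stands for the bound. As \<open>K[z]\<close> is the whole center,
  membership in it is replaced by \<open>central\<close>, and units of \<open>K[z]\<close> are
  replaced by degree 0.\<close>

locale central_irreducible = skew_polynomials \<sigma> \<delta>
  for \<sigma> \<delta> :: "'a::division_ring \<Rightarrow> 'a" +
  fixes b :: "'a poly"
  assumes degree_b: "degree b > 0"
    and central_b: "central b"
    and irreducible_b: "\<And>p q. central p \<Longrightarrow> central q \<Longrightarrow> b = p \<star> q \<Longrightarrow> degree p = 0 \<or> degree q = 0"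
    and twosided_form: "\<And>t. t \<noteq> 0 \<Longrightarrow> left_multiples t = range ((\<star>) t) \<Longrightarrow>
      \<exists>d m p. d \<noteq> 0 \<and> central p \<and> t = [:d:] \<star> monom 1 m \<star> p"
begin

lemma b_nonzero: "b \<noteq> 0"
  using degree_b by auto

lemma b_commute: "b \<star> p = p \<star> b"
  using central_b by (simp add: central_def)

abbreviation multiples :: "'a poly set" (\<open>\<I>\<close>)
  where "\<I> \<equiv> left_multiples b"

lemma I_right_closed: "p \<in> \<I> \<Longrightarrow> p \<star> q \<in> \<I>"
proof -
  assume "p \<in> \<I>"
  then obtain s where "p = s \<star> b" by blast
  then have "p \<star> q = (s \<star> q) \<star> b"
    by (simp add: mult_assoc b_commute)
  then show "p \<star> q \<in> \<I>" by blast
qed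

lemmas I_closed = left_idealD[OF left_ideal_left_multiples[of b]]

lemma b_in_I: "b \<in> \<I>"
  using left_multiplesI[of "[:1:]" b] by simp

text \<open>Because \<open>b\<close> and \<open>q\<close> are central, cancelling \<open>q\<close>
  shows that the cofactor \<open>p\<close> is central too. So irreducibility applies although only
  one factor is known to be central.\<close>

lemma central_factor:
  assumes "b = p \<star> q" "central q"
  shows "degree p = 0 \<or> degree q = 0"
proof -
  have q: "q \<noteq> 0"
    using assms(1) b_nonzero by auto
  have "central p"
    unfolding central_def
  proof
    fix s
    have "(p \<star> s) \<star> q = p \<star> (q \<star> s)"
      using assms(2) by (simp add: mult_assoc central_def)
    also have "\<dots> = (s \<star> p) \<star> q"
      using b_commute[of s] by (simp add: assms(1) mult_assoc)
    finally show "p \<star> s = s \<star> p"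
      by (rule mult_right_cancel[OF q])
  qed
  then show ?thesis
    using assms(2,1) by (rule irreducible_b)
qed

text \<open>A central constant commutes with the power of \<open>X\<close> and can be merged into
  the constant on the left.\<close>

lemma twosided_form_degree_0:
  assumes "d \<noteq> 0" "central p" "degree p = 0" "p \<noteq> 0"
  obtains c where "c \<noteq> 0" "[:d:] \<star> monom 1 m \<star> p = [:c:] \<star> monom 1 m"
proof -
  obtain k where k: "p = [:k:]" "k \<noteq> 0"
    using assms(3,4) by (metis degree_eq_zeroE pCons_0_0)
  have "[:d:] \<star> monom 1 m \<star> p = [:d:] \<star> (p \<star> monom 1 m)"
    using assms(2) by (simp add: mult_assoc central_def)
  also have "\<dots> = [:d * k:] \<star> monom 1 m"
    by (simp add: k mult_assoc[symmetric] const_mult_const)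
  finally show ?thesis
    using that[of "d * k"] assms(1) k by simp
qed

lemma left_multiples_const_mult:
  assumes "c \<noteq> 0"
  shows "left_multiples ([:c:] \<star> p) = left_multiples p"
proof
  show "left_multiples ([:c:] \<star> p) \<subseteq> left_multiples p"
    by (auto simp: mult_assoc[symmetric])
  have "p = [:inverse c:] \<star> ([:c:] \<star> p)"
    using assms by (simp add: mult_assoc[symmetric] const_mult_const)
  then have "s \<star> p \<in> left_multiples ([:c:] \<star> p)" for s
    by (metis mult_assoc rangeI)
  then show "left_multiples p \<subseteq> left_multiples ([:c:] \<star> p)"
    by auto
qed

text \<open>Write a generator as \<open>t = d X^m p\<close> and \<open>b = q t\<close>. Then
  \<open>p\<close> is a central factor of \<open>b\<close>: either \<open>p\<close> is constant and
  \<open>N = R X^m\<close>, or the cofactor \<open>q d X^m\<close> is constant and \<open>b\<close>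
  has minimal degree in \<open>N\<close>. The value \<open>m = 0\<close> accounts for
  \<open>N = R\<close>.\<close>

lemma twosided_ideal_cases:
  assumes N: "left_ideal N" "\<And>p q. p \<in> N \<Longrightarrow> p \<star> q \<in> N" "\<I> \<subseteq> N"
  shows "N = \<I> \<or> (\<exists>m. N = left_multiples (monom 1 m) \<and> N = range ((\<star>) (monom 1 m)))"
proof -
  have b: "b \<in> N"
    using N(3) b_in_I by blast
  obtain t where t: "t \<in> N" "t \<noteq> 0" "degree t = min_degree N"
    using min_degree_attained[OF b b_nonzero] .
  \<comment> \<open>Any element of minimal degree may serve as generator; this is applied to
    \<open>t\<close>, to the power of \<open>X\<close> and to \<open>b\<close>.\<close>
  have N_t: "N = left_multiples s" "N = range ((\<star>) s)" if "s \<in> N" "s \<noteq> 0" "degree s = degree t" for s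
    using twosided_ideal_eq_multiples[OF N(1,2) that(1,2)] min_degree_le[of _ N] t(3) that(3) by auto
  obtain d m p where dmp: "d \<noteq> 0" "central p" "t = [:d:] \<star> monom 1 m \<star> p"
    using twosided_form t(2) N_t[OF t(1,2)] by metis
  have p: "p \<noteq> 0"
    using dmp(3) t(2) by auto
  have "b \<in> left_multiples t"
    using b N_t[OF t(1,2)] by simp
  then obtain q where q: "b = q \<star> t"
    by blast
  show ?thesis
  proof (cases "degree p = 0")
    case True
    obtain c where c: "c \<noteq> 0" "t = [:c:] \<star> monom 1 m"
      using twosided_form_degree_0[OF dmp(1,2) True p] dmp(3) by metis
    have *: "N = left_multiples (monom 1 m)"
      using N_t(1)[OF t(1,2)] left_multiples_const_mult[OF c(1)] c(2) by simp
    then have "monom 1 m \<in> N"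
      using left_multiplesI[of "[:1:]" "monom 1 m"] by simp
    moreover have "monom 1 m \<noteq> (0 :: 'a poly)" "degree (monom 1 m :: 'a poly) = degree t"
      using c degree_mult(1)[of "[:c:]" "monom 1 m"] by simp_all
    ultimately show ?thesis
      using * N_t(2) by blast
  next
    case False
    have "b = (q \<star> ([:d:] \<star> monom 1 m)) \<star> p"
      using q dmp(3) by (simp add: mult_assoc)
    from central_factor[OF this dmp(2)] have "degree (q \<star> ([:d:] \<star> monom 1 m)) = 0"
      using False by simp
    moreover have "q \<noteq> 0"
      using q b_nonzero by auto
    ultimately have "degree q = 0"
      using degree_mult[of "[:d:]" "monom 1 m"] dmp(1) degree_mult(1)[of q "[:d:] \<star> monom 1 m"]
      by simp
    then have "degree b = degree t"
      using degree_mult(1)[OF \<open>q \<noteq> 0\<close> t(2)] q by simp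
    then show ?thesis
      using N_t(1)[OF b b_nonzero] by blast
  qed
qed

text \<open>
  If \<open>N = R X\<^sup>m\<close> with \<open>m > 0\<close>, then \<open>b = s X\<^sup>m\<close> with \<open>s\<close> twosided, so that \<open>b\<close> itself is a power of
  \<open>X\<close> up to a constant. Hence \<open>N\<close> is nilpotent modulo \<open>\<I>\<close> and contains no nonzero idempotent there.
\<close>

lemma idempotent_in_twosided_ideal:
  assumes N: "left_ideal N" "\<And>p q. p \<in> N \<Longrightarrow> p \<star> q \<in> N" "\<I> \<subseteq> N"
    and u: "u \<in> N" "u \<notin> \<I>" "u \<star> u - u \<in> \<I>"
  shows "N = UNIV"
proof -
  obtain m where m: "N = left_multiples (monom 1 m)" "N = range ((\<star>) (monom 1 m))"
    using twosided_ideal_cases[OF N] u(1,2) by blast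
  let ?x = "monom 1 m :: 'a poly"
  have x: "left_multiples ?x = range ((\<star>) ?x)"
    using m by simp
  have x_right: "\<exists>q. ?x \<star> p = q \<star> ?x" for p
  proof -
    have "?x \<star> p \<in> left_multiples ?x"
      unfolding x by (rule rangeI)
    then show ?thesis by auto
  qed
  have x_left: "\<exists>q. p \<star> ?x = ?x \<star> q" for p
  proof -
    have "p \<star> ?x \<in> range ((\<star>) ?x)"
      unfolding x[symmetric] by (rule rangeI)
    then show ?thesis by auto
  qed
  have "m = 0"
  proof (rule ccontr)
    assume "m \<noteq> 0"
    have "b \<in> left_multiples ?x"
      using N(3) b_in_I m(1) by blast
    then obtain s where s: "b = s \<star> ?x"
      by blast
    have s0: "s \<noteq> 0"
      using s b_nonzero by auto
    have x0: "?x \<noteq> 0"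
      by simp
    \<comment> \<open>Both sides agree after multiplication by \<open>?x\<close> from the right:
      \<open>p s x = p b = b p = s x p = s q x\<close>.\<close>
    have swap: "p \<star> s = s \<star> q" if "?x \<star> p = q \<star> ?x" for p q
    proof (rule mult_right_cancel[OF x0])
      show "p \<star> s \<star> ?x = s \<star> q \<star> ?x"
        using b_commute[of p] that s by (simp add: mult_assoc)
    qed
    have "left_multiples s = range ((\<star>) s)"
    proof (intro equalityI subsetI)
      fix y assume "y \<in> left_multiples s"
      then obtain p where "y = p \<star> s" by blast
      then show "y \<in> range ((\<star>) s)"
        using swap x_right[of p] by auto
    next
      fix y assume "y \<in> range ((\<star>) s)"
      then obtain q where q: "y = s \<star> q" by blast
      obtain p where "q \<star> ?x = ?x \<star> p"
        using x_left by blast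
      then show "y \<in> left_multiples s"
        using swap[of p q, symmetric] q by auto
    qed
    from twosided_form[OF s0 this]
    obtain d n p where dnp: "d \<noteq> 0" "central p" "s = [:d:] \<star> monom 1 n \<star> p"
      by blast
    have p0: "p \<noteq> 0"
      using dnp(3) s0 by auto
    \<comment> \<open>Moving the central \<open>p\<close> to the end brings the two powers of
      \<open>X\<close> together.\<close>
    have "b = ([:d:] \<star> monom 1 n \<star> ?x) \<star> p"
      using dnp(2,3) s by (simp add: mult_assoc central_def)
    moreover have "[:d:] \<star> monom 1 n \<star> ?x = [:d:] \<star> monom 1 (n + m)"
      by (simp add: mult_assoc mult_monom)
    ultimately have b: "b = [:d:] \<star> monom 1 (n + m) \<star> p"
      by simp
    have "degree ([:d:] \<star> monom 1 (n + m)) \<noteq> 0"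
      using degree_mult(1)[of "[:d:]" "monom 1 (n + m)"] dnp(1) \<open>m \<noteq> 0\<close>
      by (simp add: degree_monom_eq)
    then have "degree p = 0"
      using central_factor[OF b dnp(2)] by simp
    then obtain c where "c \<noteq> 0" "[:d:] \<star> monom 1 (n + m) \<star> p = [:c:] \<star> monom 1 (n + m)"
      by (rule twosided_form_degree_0[OF dnp(1,2) _ p0])
    then have I_eq: "\<I> = left_multiples (monom 1 (n + m))"
      using left_multiples_const_mult b by simp
    have power_right: "\<exists>q. monom 1 (k * m) \<star> p = q \<star> monom 1 (k * m)" for k p
    proof (induction k arbitrary: p)
      case (Suc k)
      obtain q where q: "monom 1 (k * m) \<star> p = q \<star> monom 1 (k * m)"
        using Suc by blast
      obtain q' where q': "?x \<star> q = q' \<star> ?x"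
        using x_right by blast
      have "monom 1 (Suc k * m) \<star> p = ?x \<star> (monom 1 (k * m) \<star> p)"
        by (simp add: mult_monom mult_assoc[symmetric])
      also have "\<dots> = q' \<star> (?x \<star> monom 1 (k * m))"
        by (simp only: q q' mult_assoc[symmetric])
      finally show ?case
        by (auto simp: mult_monom)
    qed (auto simp: monom_0)
    \<comment> \<open>Modulo \<I>, \<open>u\<close> equals each of its positive powers. Every
      further factor \<open>u = v X^m\<close> contributes another \<open>X^m\<close>, which collects
      on the right since powers of \<open>X^m\<close> can be moved past any polynomial.\<close>
    have "\<exists>w. w \<star> monom 1 (Suc k * m) - u \<in> \<I>" for k
    proof (induction k)
      case 0
      obtain v where "u = v \<star> ?x"
        using u(1) m(1) by blast
      then have "v \<star> monom 1 (Suc 0 * m) - u = 0"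
        by simp
      then show ?case
        using I_closed(1) by metis
    next
      case (Suc k)
      let ?y = "monom 1 (Suc k * m)"
      obtain w where w: "w \<star> ?y - u \<in> \<I>"
        using Suc by blast
      obtain v where v: "u = v \<star> ?x"
        using u(1) m(1) by blast
      obtain v' where v': "?y \<star> v = v' \<star> ?y"
        using power_right[of "Suc k" v] by blast
      have "(w \<star> ?y - u) \<star> u + (u \<star> u - u) \<in> \<I>"
        using w u(3) by (intro I_closed(2) I_right_closed)
      also have "(w \<star> ?y - u) \<star> u + (u \<star> u - u) = w \<star> (?y \<star> u) - u"
        by (simp add: mult_simps)
      also have "?y \<star> u = v' \<star> ?y \<star> ?x"
        by (simp only: v v' mult_assoc[symmetric])
      also have "\<dots> = v' \<star> monom 1 (Suc (Suc k) * m)"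
        by (simp add: mult_monom mult_assoc algebra_simps)
      finally have "(w \<star> v') \<star> monom 1 (Suc (Suc k) * m) - u \<in> \<I>"
        by (simp only: mult_assoc)
      then show ?case
        by (rule exI)
    qed
    then obtain w where w: "w \<star> monom 1 (Suc (n + m) * m) - u \<in> \<I>"
      by blast
    \<comment> \<open>With \<open>k = n + m\<close> the exponent is large enough for the power of
      \<open>X\<close> to lie in \<I>, because \<open>m\<close> is at least 1.\<close>
    have "n + m \<le> Suc (n + m) * m"
      using mult_le_mono2[of 1 m "Suc (n + m)"] \<open>m \<noteq> 0\<close> by simp
    then have "monom 1 (Suc (n + m) * m) =
        monom 1 (Suc (n + m) * m - (n + m)) \<star> monom 1 (n + m)"
      by (simp only: mult_monom le_add_diff_inverse2)
    then have "w \<star> monom 1 (Suc (n + m) * m) =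
        (w \<star> monom 1 (Suc (n + m) * m - (n + m))) \<star> monom 1 (n + m)"
      by (simp only: mult_assoc)
    then have "w \<star> monom 1 (Suc (n + m) * m) \<in> \<I>"
      unfolding I_eq by (simp only: left_multiplesI)
    from I_closed(5)[OF this w] have "u \<in> \<I>"
      by simp
    with u(2) show False ..
  qed
  then have "[:1:] \<in> N"
    using left_multiplesI[of "[:1:]" "monom 1 m"] m(1) by (simp add: monom_0)
  then have "p \<in> N" for p
    using left_idealD(3)[OF N(1), of "[:1:]" p] by simp
  then show ?thesis
    by blast
qed

end

section \<open>Corners of a ring\<close>

text \<open>For idempotent \<open>u\<close> this is the set of all
  \<open>u \<otimes> x \<otimes> u\<close>; the fixed point form turns membership into two
  equations.\<close>

definition (in ring) corner :: "'a \<Rightarrow> 'a set" where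
  "corner u = {x \<in> carrier R. u \<otimes> x = x \<and> x \<otimes> u = x}"

context ring
begin

lemma cornerD:
  assumes "x \<in> corner u"
  shows "x \<in> carrier R" "u \<otimes> x = x" "x \<otimes> u = x"
  using assms by (simp_all add: corner_def)

lemma corner_mult_closed:
  assumes "u \<in> carrier R" "x \<in> corner u" "y \<in> corner u"
  shows "x \<otimes> y \<in> corner u"
proof -
  note xy = cornerD[OF assms(2)] cornerD[OF assms(3)]
  have "u \<otimes> (x \<otimes> y) = u \<otimes> x \<otimes> y"
    using assms(1) xy(1,4) by (simp only: m_assoc)
  then show ?thesis
    using assms(1) xy by (simp add: corner_def m_assoc)
qed

text \<open>Exponents start at 1, since \<open>x [^] 0\<close> is the one of the whole ring, which
  lies in the corner only if \<open>u = \<one>\<close>.\<close>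

lemma corner_power_closed:
  assumes "u \<in> carrier R" "x \<in> corner u"
  shows "x [^] Suc n \<in> corner u"
proof (induction n)
  case 0
  then show ?case using assms cornerD(1)[OF assms(2)] by simp
next
  case (Suc n)
  then show ?case
    using corner_mult_closed[OF assms(1) Suc assms(2)] by simp
qed

text \<open>
  The kernel condition is the ascending chain condition for the annihilators of the powers of \<open>x\<close>;
  it makes the corner Dedekind finite.
\<close>

lemma left_invertible_not_zero_divisor:
  assumes u: "u \<in> carrier R" and x: "x \<in> corner u" and y: "y \<in> corner u"
    and c: "c \<in> carrier R" "c \<otimes> x = u"
    and kernel: "\<And>b. b \<in> carrier R \<Longrightarrow> b \<otimes> x [^] Suc n = \<zero> \<Longrightarrow> b \<otimes> x [^] (n::nat) = \<zero>"
    and zero: "x \<otimes> y = \<zero> \<or> y \<otimes> x = \<zero>"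
  shows "y = \<zero>"
proof (cases "x \<otimes> y = \<zero>")
  case True
  have "y = c \<otimes> x \<otimes> y"
    using cornerD[OF y] c by simp
  also have "\<dots> = c \<otimes> (x \<otimes> y)"
    using c(1) cornerD(1)[OF x] cornerD(1)[OF y] by (simp only: m_assoc)
  finally show ?thesis
    using True c by simp
next
  case False
  note xy = cornerD[OF x] cornerD[OF y]
  \<comment> \<open>The product \<open>c [^] k \<otimes> x [^] k\<close> is \<open>\<one>\<close>
    for \<open>k = 0\<close> and \<open>u\<close> for \<open>k > 0\<close>; both fix
    \<open>y\<close> from the right.\<close>
  have cancel: "y \<otimes> c [^] k \<otimes> x [^] k = y" for k :: nat
  proof (induction k)
    case 0
    then show ?case using xy by simp
  next
    case (Suc k)
    have "y \<otimes> c [^] Suc k \<otimes> x [^] Suc k = y \<otimes> c [^] k \<otimes> (c \<otimes> x) \<otimes> x [^] k"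
      using xy c(1) nat_pow_Suc2[of x k] by (simp add: m_assoc)
    also have "\<dots> = y \<otimes> c [^] k \<otimes> (u \<otimes> x [^] k)"
      using xy c u by (simp add: m_assoc)
    also have "\<dots> = y"
    proof (cases k)
      case 0
      then show ?thesis using xy u by simp
    next
      case (Suc j)
      then have "u \<otimes> x [^] k = x [^] k"
        using corner_power_closed[OF u x] cornerD(2) by blast
      then show ?thesis using Suc.IH by simp
    qed
    finally show ?case .
  qed
  \<comment> \<open>By \<open>cancel\<close> this is \<open>y \<otimes> x = \<zero>\<close>. The
    kernel condition then removes one factor \<open>x\<close>, and \<open>cancel\<close> turns what
    remains into \<open>y = \<zero>\<close>.\<close>
  have "y \<otimes> c [^] n \<otimes> x [^] Suc n = y \<otimes> c [^] n \<otimes> x [^] n \<otimes> x"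
    using xy c by (simp add: m_assoc)
  also have "\<dots> = \<zero>"
    using cancel[of n] False zero by simp
  finally have "y \<otimes> c [^] n \<otimes> x [^] n = \<zero>"
    using kernel[of "y \<otimes> c [^] n"] xy c by simp
  then show ?thesis
    using cancel[of n] by simp
qed

text \<open>
  Without zero divisors the descending chain condition for the left ideals generated by the powers
  of \<open>x\<close> makes every nonzero \<open>x\<close> in the corner invertible there; apply this to some \<open>u q w \<noteq> 0\<close>.
\<close>

lemma division_corner_generates:
  assumes u: "u \<in> carrier R" "u \<otimes> u = u"
    and domain: "\<And>x y. x \<in> corner u \<Longrightarrow> y \<in> corner u \<Longrightarrow> x \<otimes> y = \<zero> \<Longrightarrow> x = \<zero> \<or> y = \<zero>"
    and chain: "\<And>x. x \<in> carrier R \<Longrightarrow> \<exists>n::nat. \<exists>b\<in>carrier R. x [^] n = b \<otimes> x [^] Suc n"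
    and w: "w \<in> carrier R" "w \<otimes> u = w"
    and q: "q \<in> carrier R" "u \<otimes> q \<otimes> w \<noteq> \<zero>"
  shows "\<exists>c\<in>carrier R. u = c \<otimes> w"
proof -
  define x where "x = u \<otimes> q \<otimes> w"
  have "u \<otimes> (u \<otimes> q \<otimes> w) = u \<otimes> u \<otimes> q \<otimes> w"
    using u(1) w q(1) by (simp add: m_assoc)
  then have x: "x \<in> corner u"
    using u w q(1) by (simp add: x_def corner_def m_assoc)
  note x' = cornerD[OF x]
  obtain n :: nat and b where b: "b \<in> carrier R" "x [^] n = b \<otimes> x [^] Suc n"
    using chain[OF x'(1)] by blast
  define c where "c = u \<otimes> b \<otimes> u"
  have "u \<otimes> (u \<otimes> b \<otimes> u) = u \<otimes> u \<otimes> b \<otimes> u"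
    using u(1) b by (simp add: m_assoc)
  then have c: "c \<in> corner u"
    using u b by (simp add: c_def corner_def m_assoc)
  note c' = cornerD[OF c]
  have pow: "x [^] Suc k \<in> corner u" for k
    by (rule corner_power_closed[OF u(1) x])
  have pow_nonzero: "x [^] Suc k \<noteq> \<zero>" for k
  proof (induction k)
    case 0
    then show ?case using q(2) x' by (simp add: x_def)
  next
    case (Suc k)
    then show ?case using domain[OF pow x] q(2) by (auto simp: x_def)
  qed
  \<comment> \<open>The relation for \<open>x [^] n\<close> is multiplied by \<open>x\<close> from
    the right, so that only positive powers of \<open>x\<close> occur, which lie in the corner even
    for \<open>n = 0\<close>.\<close>
  have "c \<otimes> x \<otimes> x [^] Suc n = u \<otimes> (b \<otimes> (u \<otimes> (x \<otimes> x [^] Suc n)))"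
    using u b x'(1) by (simp add: c_def m_assoc)
  also have "u \<otimes> (x \<otimes> x [^] Suc n) = x [^] Suc n \<otimes> x"
    using nat_pow_Suc2[OF x'(1), of "Suc n"] cornerD(2)[OF pow[of "Suc n"]] by simp
  also have "u \<otimes> (b \<otimes> (x [^] Suc n \<otimes> x)) = u \<otimes> (b \<otimes> x [^] Suc n) \<otimes> x"
    using u b(1) x'(1) by (simp add: m_assoc)
  also have "\<dots> = u \<otimes> x [^] n \<otimes> x"
    by (simp only: b(2)[symmetric])
  also have "\<dots> = u \<otimes> x [^] Suc n"
    using u x'(1) by (simp add: m_assoc)
  finally have "(u \<ominus> c \<otimes> x) \<otimes> x [^] Suc n = \<zero>"
    using u(1) c'(1) x'(1) by (simp add: minus_eq l_distr l_minus r_neg)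
  moreover have "u \<ominus> c \<otimes> x \<in> corner u"
    using u c' x' by (simp add: corner_def minus_eq l_distr r_distr l_minus r_minus)
      (metis m_assoc)
  ultimately have "u \<ominus> c \<otimes> x = \<zero>"
    using domain pow pow_nonzero by blast
  then have "u = c \<otimes> x"
    using u(1) c'(1) x'(1) by simp
  then have "u = (c \<otimes> u \<otimes> q) \<otimes> w"
    using u(1) c'(1) q(1) w(1) by (simp add: x_def m_assoc)
  then show ?thesis
    using u(1) c'(1) q(1) by blast
qed

end

section \<open>Corner algebras of a quotient ring and their scalars\<close>

context ideal
begin

lemma quotient_carrierE:
  assumes "x \<in> carrier (R Quot I)"
  obtains g where "g \<in> carrier R" "x = I +> g"
  using assms by (auto simp: FactRing_simps)

lemma coset_closed: "g \<in> carrier R \<Longrightarrow> I +> g \<in> carrier (R Quot I)"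
  by (auto simp: FactRing_simps)

lemma corner_algebra_simps [simp]:
  "mult (corner_algebra R I u) = mult (R Quot I)"
  "one (corner_algebra R I u) = u"
  "zero (corner_algebra R I u) = zero (R Quot I)"
  "add (corner_algebra R I u) = add (R Quot I)"
  "smult (corner_algebra R I u) k x = (k <+>\<^bsub>R\<^esub> I) \<otimes>\<^bsub>R Quot I\<^esub> x"
  by (simp_all add: corner_algebra_def)

lemma carrier_corner_algebra:
  assumes "u \<in> carrier (R Quot I)" "u \<otimes>\<^bsub>R Quot I\<^esub> u = u"
  shows "carrier (corner_algebra R I u) = ring.corner (R Quot I) u"
proof -
  interpret A: ring "R Quot I"
    by (rule quotient_is_ring)
  have "u \<otimes>\<^bsub>R Quot I\<^esub> (u \<otimes>\<^bsub>R Quot I\<^esub> y) = u \<otimes>\<^bsub>R Quot I\<^esub> y" if "y \<in> carrier (R Quot I)" for y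
    using assms that by (simp flip: A.m_assoc)
  then show ?thesis
    using assms unfolding corner_algebra_def A.corner_def
    by (auto simp: A.m_assoc) metis
qed

lemma ring_corner_algebra:
  assumes u: "u \<in> carrier (R Quot I)" "u \<otimes>\<^bsub>R Quot I\<^esub> u = u"
  shows "ring (corner_algebra R I u)"
proof -
  interpret A: ring "R Quot I"
    by (rule quotient_is_ring)
  note C = carrier_corner_algebra[OF u]
  show ?thesis
  proof (rule ringI)
    show "abelian_group (corner_algebra R I u)"
    proof (rule abelian_groupI, simp_all add: C)
      fix x assume x: "x \<in> A.corner u"
      show "\<exists>y\<in>A.corner u. y \<oplus>\<^bsub>R Quot I\<^esub> x = \<zero>\<^bsub>R Quot I\<^esub>"
        using x u(1) by (intro bexI[of _ "\<ominus>\<^bsub>R Quot I\<^esub> x"])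
          (auto simp: A.corner_def A.l_neg A.l_minus A.r_minus)
    qed (use u in \<open>auto simp: A.corner_def A.add.m_ac A.l_distr A.r_distr\<close>)
    show "Group.monoid (corner_algebra R I u)"
      using u A.corner_mult_closed[OF u(1)]
      by (intro monoidI) (auto simp: C A.corner_def A.m_assoc)
  qed (auto simp: C A.corner_def A.l_distr A.r_distr)
qed

end

lemma (in ring) subring_ring_center: "subring (ring_center R) R"
proof (rule subringI)
  show "a \<oplus> b \<in> ring_center R" if "a \<in> ring_center R" "b \<in> ring_center R" for a b
    using that by (auto simp: ring_center_def l_distr r_distr)
  show "\<ominus> a \<in> ring_center R" if "a \<in> ring_center R" for a
    using that by (auto simp: ring_center_def l_minus r_minus)
  show "a \<otimes> b \<in> ring_center R" if "a \<in> ring_center R" "b \<in> ring_center R" for a b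
  proof -
    have ab: "a \<in> carrier R" "b \<in> carrier R"
      using that by (simp_all add: ring_center_def)
    have "a \<otimes> b \<otimes> x = x \<otimes> (a \<otimes> b)" if x: "x \<in> carrier R" for x
    proof -
      have "a \<otimes> b \<otimes> x = a \<otimes> (x \<otimes> b)"
        using ab x \<open>b \<in> ring_center R\<close> by (simp add: ring_center_def m_assoc)
      also have "\<dots> = a \<otimes> x \<otimes> b"
        using ab x by (simp add: m_assoc)
      also have "a \<otimes> x = x \<otimes> a"
        using x \<open>a \<in> ring_center R\<close> by (simp add: ring_center_def)
      finally show ?thesis
        using ab x by (simp add: m_assoc)
    qed
    then show ?thesis
      using ab by (simp add: ring_center_def)
  qed
qed (auto simp: ring_center_def)

lemma (in ring) cring_ring_center: "cring (R\<lparr>carrier := ring_center R\<rparr>)"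
proof -
  have "subcring (ring_center R) R"
    by (rule subcringI[OF subring_ring_center]) (unfold ring_center_def, blast)
  then show ?thesis
    using subcring_iff[of "ring_center R"] by (auto simp: ring_center_def)
qed

text \<open>As \<open>J \<subseteq> I\<close>, the scalar \<open>s + J\<close> acts as the coset of
  \<open>s\<close> modulo \<open>I\<close>. That coset is central in the quotient, so the module and
  algebra axioms reduce to ring laws there.\<close>

lemma (in ideal) assoc_algebra_corner_algebra:
  assumes u: "u \<in> carrier (R Quot I)" "u \<otimes>\<^bsub>R Quot I\<^esub> u = u"
    and J: "ideal J (R\<lparr>carrier := ring_center R\<rparr>)" "J \<subseteq> I"
  shows "assoc_algebra (R\<lparr>carrier := ring_center R\<rparr> Quot J) (corner_algebra R I u)"
proof -
  let ?A = "R Quot I" and ?S = "R\<lparr>carrier := ring_center R\<rparr>" and ?B = "corner_algebra R I u"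
  interpret A: ring ?A
    by (rule quotient_is_ring)
  interpret B: ring ?B
    by (rule ring_corner_algebra[OF u])
  interpret S: cring ?S
    by (rule cring_ring_center)
  interpret J: ideal J ?S
    by (rule J(1))
  interpret F: cring "?S Quot J"
    by (rule J.quotient_is_cring[OF S.is_cring])
  interpret pi: ring_hom_ring R ?A "(+>) I"
    by (rule rcos_ring_hom_ring)
  interpret rho: ring_hom_ring ?S "?S Quot J" "(+>\<^bsub>?S\<^esub>) J"
    by (rule J.rcos_ring_hom_ring)
  note C = carrier_corner_algebra[OF u]
  have center: "s \<in> carrier R" "s \<otimes> x = x \<otimes> s" if "s \<in> ring_center R" "x \<in> carrier R" for s x
    using that by (auto simp: ring_center_def)
  \<comment> \<open>Adding \<open>I\<close> to the set \<open>J + s\<close> absorbs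
    \<open>J\<close>; hence the action does not depend on the representative
    \<open>s\<close>.\<close>
  have scalar: "(J +>\<^bsub>?S\<^esub> s) <+>\<^bsub>R\<^esub> I = I +> s" if s: "s \<in> ring_center R" for s
  proof -
    have sR: "s \<in> carrier R"
      using s by (simp add: ring_center_def)
    have JI: "j \<in> carrier R" "j \<in> I" if "j \<in> J" for j
      using that J(2) a_Hcarr by auto
    show ?thesis
    proof (intro equalityI subsetI)
      fix y assume "y \<in> (J +>\<^bsub>?S\<^esub> s) <+>\<^bsub>R\<^esub> I"
      then obtain j i where ji: "j \<in> J" "i \<in> I" "y = (j \<oplus> s) \<oplus> i"
        by (auto simp: set_add_def' a_r_coset_def')
      then have "y = (j \<oplus> i) \<oplus> s"
        using JI sR a_Hcarr by (simp add: a_assoc a_comm a_lcomm)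
      then show "y \<in> I +> s"
        using JI ji by (auto simp: a_r_coset_def' intro!: bexI[of _ "j \<oplus> i"])
    next
      fix y assume "y \<in> I +> s"
      then obtain i where i: "i \<in> I" "y = i \<oplus> s"
        by (auto simp: a_r_coset_def')
      then have "y = (\<zero> \<oplus> s) \<oplus> i"
        using sR a_Hcarr by (simp add: a_comm)
      then show "y \<in> (J +>\<^bsub>?S\<^esub> s) <+>\<^bsub>R\<^esub> I"
        using J.zero_closed i by (force simp: set_add_def' a_r_coset_def')
    qed
  qed
  have elim: "\<exists>s\<in>ring_center R. k = J +>\<^bsub>?S\<^esub> s" if "k \<in> carrier (?S Quot J)" for k
    using J.quotient_carrierE[OF that] by auto
  have comm: "(I +> s) \<otimes>\<^bsub>?A\<^esub> x = x \<otimes>\<^bsub>?A\<^esub> (I +> s)"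
    if "s \<in> ring_center R" "x \<in> carrier ?A" for s x
    using that(2)
  proof (rule quotient_carrierE)
    fix g assume "g \<in> carrier R" "x = I +> g"
    then show ?thesis
      using center[OF that(1)] by (simp flip: pi.hom_mult)
  qed
  have closed: "I +> s \<in> carrier ?A" if "s \<in> ring_center R" for s
    using that by (simp add: ring_center_def coset_closed)
  have comm': "x \<otimes>\<^bsub>?A\<^esub> ((I +> s) \<otimes>\<^bsub>?A\<^esub> y) = (I +> s) \<otimes>\<^bsub>?A\<^esub> (x \<otimes>\<^bsub>?A\<^esub> y)"
    if s: "s \<in> ring_center R" and xy: "x \<in> carrier ?A" "y \<in> carrier ?A" for s x y
  proof -
    have "x \<otimes>\<^bsub>?A\<^esub> ((I +> s) \<otimes>\<^bsub>?A\<^esub> y) = (x \<otimes>\<^bsub>?A\<^esub> (I +> s)) \<otimes>\<^bsub>?A\<^esub> y"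
      using xy closed[OF s] by (simp only: A.m_assoc)
    also have "\<dots> = (I +> s) \<otimes>\<^bsub>?A\<^esub> x \<otimes>\<^bsub>?A\<^esub> y"
      using comm[OF s xy(1)] by simp
    finally show ?thesis
      using xy closed[OF s] by (simp only: A.m_assoc)
  qed
  have sums: "s \<oplus> t \<in> ring_center R" "s \<otimes> t \<in> ring_center R"
    if "s \<in> ring_center R" "t \<in> ring_center R" for s t
    using S.add.m_closed[of s t] S.m_closed[of s t] that by simp_all
  have "module (?S Quot J) ?B"
  proof (rule moduleI)
    show "cring (?S Quot J)" ..
    show "abelian_group ?B" ..
    fix k l x y
    assume "k \<in> carrier (?S Quot J)" and x: "x \<in> carrier ?B"
    then obtain s where s: "s \<in> ring_center R" "k = J +>\<^bsub>?S\<^esub> s"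
      using elim by blast
    note x' = A.cornerD[OF x[unfolded C]]
    show "k \<odot>\<^bsub>?B\<^esub> x \<in> carrier ?B"
      using s x' u closed comm'[OF s(1) u(1) x'(1)]
      by (simp add: C scalar A.corner_def A.m_assoc)
    show "k \<odot>\<^bsub>?B\<^esub> (x \<oplus>\<^bsub>?B\<^esub> y) = (k \<odot>\<^bsub>?B\<^esub> x) \<oplus>\<^bsub>?B\<^esub> (k \<odot>\<^bsub>?B\<^esub> y)" if "y \<in> carrier ?B"
      using s x' closed A.cornerD(1)[OF that[unfolded C]] by (simp add: scalar A.r_distr)
    assume "l \<in> carrier (?S Quot J)"
    then obtain t where t: "t \<in> ring_center R" "l = J +>\<^bsub>?S\<^esub> t"
      using elim by blast
    have kl: "k \<oplus>\<^bsub>?S Quot J\<^esub> l = J +>\<^bsub>?S\<^esub> (s \<oplus> t)" "k \<otimes>\<^bsub>?S Quot J\<^esub> l = J +>\<^bsub>?S\<^esub> (s \<otimes> t)"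
      using s t rho.hom_add[of s t] rho.hom_mult[of s t] by simp_all
    have "s \<in> carrier R" "t \<in> carrier R"
      using s(1) t(1) by (simp_all add: ring_center_def)
    then have hom: "I +> (s \<oplus> t) = (I +> s) \<oplus>\<^bsub>?A\<^esub> (I +> t)"
      "I +> (s \<otimes> t) = (I +> s) \<otimes>\<^bsub>?A\<^esub> (I +> t)"
      by simp_all
    note scalars = scalar[OF s(1)] scalar[OF t(1)] sums[OF s(1) t(1), THEN scalar]
    show "(k \<oplus>\<^bsub>?S Quot J\<^esub> l) \<odot>\<^bsub>?B\<^esub> x = (k \<odot>\<^bsub>?B\<^esub> x) \<oplus>\<^bsub>?B\<^esub> (l \<odot>\<^bsub>?B\<^esub> x)"
      unfolding corner_algebra_simps kl unfolding s(2) t(2) scalars hom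
      by (rule A.l_distr[OF closed[OF s(1)] closed[OF t(1)] x'(1)])
    show "(k \<otimes>\<^bsub>?S Quot J\<^esub> l) \<odot>\<^bsub>?B\<^esub> x = k \<odot>\<^bsub>?B\<^esub> (l \<odot>\<^bsub>?B\<^esub> x)"
      unfolding corner_algebra_simps kl unfolding s(2) t(2) scalars hom
      by (rule A.m_assoc[OF closed[OF s(1)] closed[OF t(1)] x'(1)])
  next
    fix x assume x: "x \<in> carrier ?B"
    have "\<one>\<^bsub>?S Quot J\<^esub> = J +>\<^bsub>?S\<^esub> \<one>"
      using rho.hom_one by simp
    then show "\<one>\<^bsub>?S Quot J\<^esub> \<odot>\<^bsub>?B\<^esub> x = x"
      using S.one_closed A.cornerD(1)[OF x[unfolded C]] by (simp add: scalar)
  qed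
  moreover have "(k \<odot>\<^bsub>?B\<^esub> x) \<otimes>\<^bsub>?B\<^esub> y = k \<odot>\<^bsub>?B\<^esub> (x \<otimes>\<^bsub>?B\<^esub> y) \<and> x \<otimes>\<^bsub>?B\<^esub> (k \<odot>\<^bsub>?B\<^esub> y) = k \<odot>\<^bsub>?B\<^esub> (x \<otimes>\<^bsub>?B\<^esub> y)"
    if k: "k \<in> carrier (?S Quot J)" and x: "x \<in> carrier ?B" and y: "y \<in> carrier ?B" for k x y
  proof -
    obtain s where s: "s \<in> ring_center R" "k = J +>\<^bsub>?S\<^esub> s"
      using elim[OF k] by blast
    have xy: "x \<in> carrier ?A" "y \<in> carrier ?A"
      using x y by (simp_all add: C A.corner_def)
    show ?thesis
      using s xy closed comm'[OF s(1) xy] by (simp add: scalar A.m_assoc)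
  qed
  ultimately show ?thesis
    unfolding assoc_algebra_def using B.ring_axioms by blast
qed

section \<open>Quotients of Ore extensions\<close>

context skew_polynomials
begin

abbreviation ore_ring :: "'a poly ring" (\<open>\<R>\<close>)
  where "\<R> \<equiv> ore_extension \<sigma> \<delta>"

lemma ore_extension_simps [simp]:
  "carrier \<R> = UNIV" "p \<otimes>\<^bsub>\<R>\<^esub> q = p \<star> q" "\<one>\<^bsub>\<R>\<^esub> = [:1:]" "\<zero>\<^bsub>\<R>\<^esub> = 0" "p \<oplus>\<^bsub>\<R>\<^esub> q = p + q"
  by (simp_all add: ore_extension_def)

lemma ring_R: "ring \<R>"
  by (rule ring_ore_extension[OF aut der])

lemma PIdl_R: "PIdl\<^bsub>\<R>\<^esub> t = left_multiples t"
  by (auto simp: cgenideal_def)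

lemma twosided_iff: "twosided \<R> t \<longleftrightarrow> left_multiples t = range ((\<star>) t)"
  by (auto simp: twosided_def PIdl_R l_coset_def)

lemma ann_quotient_R: "ann_quotient \<R> f = {p. \<forall>q. p \<star> q \<in> left_multiples f}"
  by (simp add: ann_quotient_def PIdl_R)

lemma ring_center_R: "ring_center \<R> = {p. central p}"
  by (simp add: ring_center_def central_def)

lemma ore_X_pow: "ore_X [^]\<^bsub>\<R>\<^esub> (m::nat) = monom 1 m"
proof -
  have X: "ore_X = monom 1 1"
    by (simp add: ore_X_def monom_Suc monom_0)
  interpret ring \<R> by (rule ring_R)
  show ?thesis
    by (induction m) (simp_all add: X mult_monom monom_0)
qed

lemma Units_R: "p \<in> Units \<R> \<longleftrightarrow> p \<noteq> 0 \<and> degree p = 0"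
proof
  assume "p \<in> Units \<R>"
  then obtain q where q: "p \<star> q = [:1:]"
    by (auto simp: Units_def)
  then have "p \<noteq> 0" "q \<noteq> 0"
    by auto
  then show "p \<noteq> 0 \<and> degree p = 0"
    using q degree_mult(1)[of p q] by simp
next
  assume "p \<noteq> 0 \<and> degree p = 0"
  then obtain q where "p \<star> q = [:1:]" "q \<star> p = [:1:]"
    using degree_0_inverse[of p] by metis
  then show "p \<in> Units \<R>"
    by (auto simp: Units_def)
qed

lemma left_multiples_UNIV_iff: "left_multiples p = UNIV \<longleftrightarrow> p \<in> Units \<R>"
proof
  assume "left_multiples p = UNIV"
  then have "[:1:] \<in> left_multiples p"
    by simp
  then obtain q where q: "q \<star> p = [:1:]"
    by auto
  then have "p \<noteq> 0" "q \<noteq> 0"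
    by auto
  then show "p \<in> Units \<R>"
    using q degree_mult(1)[of q p] by (simp add: Units_R)
next
  assume "p \<in> Units \<R>"
  then obtain q where "q \<star> p = [:1:]"
    by (auto simp: Units_def)
  then have "s = (s \<star> q) \<star> p" for s
    by (simp add: mult_assoc)
  then show "left_multiples p = UNIV"
    using left_multiplesI by (metis UNIV_eq_I)
qed

text \<open>Translates irreducibility in the commutative ring \<open>Z\<close> into degrees. In
  \<open>b = p \<star> q\<close> either \<open>p\<close> is a proper factor and thus a unit, or
  \<open>b\<close> divides \<open>p\<close> and comparing degrees leaves degree 0 for
  \<open>q\<close>.\<close>

lemma central_irreducibleI:
  assumes Kz: "ring_center \<R> = Z"
    and irr: "ring_irreducible\<^bsub>\<R>\<lparr>carrier := Z\<rparr>\<^esub> b"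
    and b: "b \<in> Z"
    and twosided: "\<forall>t. t \<noteq> 0 \<and> twosided \<R> t \<longrightarrow>
      (\<exists>d m \<alpha>. d \<noteq> 0 \<and> \<alpha> \<in> Z \<and> t = [:d:] \<otimes>\<^bsub>\<R>\<^esub> (ore_X [^]\<^bsub>\<R>\<^esub> (m::nat)) \<otimes>\<^bsub>\<R>\<^esub> \<alpha>)"
  shows "central_irreducible \<sigma> \<delta> b"
proof
  let ?S = "\<R>\<lparr>carrier := Z\<rparr>"
  have Z: "p \<in> Z \<longleftrightarrow> central p" for p
    using Kz ring_center_R by auto
  show cb: "central b"
    using b Z by simp
  have b0: "b \<noteq> 0"
    using irr by (simp add: ring_irreducible_def)
  have b_irr: "p \<in> Units ?S" if "p \<in> Z" "properfactor ?S p b" for p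
    using irr that by (simp add: ring_irreducible_def Divisibility.irreducible_def)
  show "degree b > 0"
  proof (rule ccontr)
    assume "\<not> degree b > 0"
    then obtain q where q: "b \<star> q = [:1:]" "q \<star> b = [:1:]"
      using degree_0_inverse[of b] b0 by auto
    \<comment> \<open>The inverse of a central element is central, so a constant \<open>b\<close>
      would be a unit already in \<open>Z\<close>.\<close>
    have "q \<star> p = p \<star> q" for p
    proof -
      have "q \<star> p = q \<star> (p \<star> b) \<star> q"
        by (simp add: mult_assoc q(1))
      also have "p \<star> b = b \<star> p"
        using cb by (simp add: central_def)
      finally show ?thesis
        by (simp add: mult_assoc[symmetric] q(2))
    qed
    then have "q \<in> Z"
      by (simp add: Z central_def)
    then have "b \<in> Units ?S"
      using q b by (auto simp: Units_def)
    then show False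
      using irr by (simp add: ring_irreducible_def Divisibility.irreducible_def)
  qed
  show "degree p = 0 \<or> degree q = 0" if p: "central p" and q: "central q" and pq: "b = p \<star> q" for p q
  proof (cases "properfactor ?S p b")
    case True
    then have "p \<in> Units ?S"
      using b_irr p True Z by simp
    then have "p \<in> Units \<R>"
      by (auto simp: Units_def)
    then show ?thesis
      by (simp add: Units_R)
  next
    case False
    have "p divides\<^bsub>?S\<^esub> b"
      using pq q Z by (auto simp: factor_def)
    then have "b divides\<^bsub>?S\<^esub> p"
      using False by (simp add: properfactor_def)
    then obtain c where c: "p = b \<star> c"
      by (auto simp: factor_def)
    have nonzero: "p \<noteq> 0" "q \<noteq> 0" "c \<noteq> 0"
      using c pq b0 by auto
    have "degree p = degree b + degree c"
      using degree_mult(1)[OF b0 nonzero(3), folded c] .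
    moreover have "degree b = degree p + degree q"
      using degree_mult(1)[OF nonzero(1,2), folded pq] .
    ultimately show ?thesis
      by simp
  qed
  show "\<exists>d m p. d \<noteq> 0 \<and> central p \<and> t = [:d:] \<star> monom 1 m \<star> p"
    if t: "t \<noteq> 0" "left_multiples t = range ((\<star>) t)" for t
  proof -
    have "twosided \<R> t"
      unfolding twosided_iff by (rule t(2))
    with t(1) twosided obtain d m p where "d \<noteq> 0" "p \<in> Z"
      "t = [:d:] \<otimes>\<^bsub>\<R>\<^esub> (ore_X [^]\<^bsub>\<R>\<^esub> (m::nat)) \<otimes>\<^bsub>\<R>\<^esub> p"
      by blast
    then have "d \<noteq> 0" "central p" "t = [:d:] \<star> monom 1 m \<star> p"
      by (simp_all only: ore_extension_simps ore_X_pow Z not_False_eq_True)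
    then show ?thesis
      by blast
  qed
qed

end

section \<open>The quotient \<open>R/Rb\<close> and its chain conditions\<close>

context central_irreducible
begin

lemma ideal_I: "ideal \<I> \<R>"
proof -
  interpret ring \<R> by (rule ring_R)
  have "additive_subgroup \<I> \<R>"
  proof (rule additive_subgroupI, rule add.subgroupI)
    show "\<I> \<noteq> {}" by simp
    fix p q assume pq: "p \<in> \<I>" "q \<in> \<I>"
    have "\<ominus>\<^bsub>\<R>\<^esub> p = - p"
      by (rule minus_equality) simp_all
    then show "\<ominus>\<^bsub>\<R>\<^esub> p \<in> \<I>"
      using I_closed(4)[OF pq(1)] by simp
    show "p \<oplus>\<^bsub>\<R>\<^esub> q \<in> \<I>"
      using I_closed(2)[OF pq] by simp
  qed simp
  then show ?thesis
    using I_closed(3) I_right_closed by (intro idealI ring_R) (auto simp: additive_subgroup_def)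
qed

sublocale I: ideal \<I> \<R>
  by (rule ideal_I)

sublocale pi: ring_hom_ring \<R> "\<R> Quot \<I>" "(+>\<^bsub>\<R>\<^esub>) \<I>"
  by (rule I.rcos_ring_hom_ring)

abbreviation quotient_ring :: "'a poly set ring" (\<open>\<A>\<close>)
  where "\<A> \<equiv> \<R> Quot \<I>"

abbreviation coset :: "'a poly \<Rightarrow> 'a poly set"
  where "coset p \<equiv> \<I> +>\<^bsub>\<R>\<^esub> p"

lemma coset_mult: "coset (p \<star> q) = coset p \<otimes>\<^bsub>\<A>\<^esub> coset q"
  and coset_add: "coset (p + q) = coset p \<oplus>\<^bsub>\<A>\<^esub> coset q"
  and coset_one: "coset [:1:] = \<one>\<^bsub>\<A>\<^esub>"
  and coset_closed: "coset p \<in> carrier \<A>"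
  using pi.hom_mult[of p q] pi.hom_add[of p q] pi.hom_one pi.hom_closed[of p] by simp_all

lemma coset_eq_iff: "coset p = coset q \<longleftrightarrow> p - q \<in> \<I>"
proof
  assume "coset p = coset q"
  moreover have "p \<in> coset p"
    using I_closed(1) by (force simp: a_r_coset_def')
  ultimately obtain i where "i \<in> \<I>" "p = i + q"
    by (auto simp: a_r_coset_def')
  then show "p - q \<in> \<I>"
    by simp
next
  have *: "coset p \<subseteq> coset q" if "p - q \<in> \<I>" for p q
  proof
    fix y assume "y \<in> coset p"
    then obtain i where i: "i \<in> \<I>" "y = i + p"
      by (auto simp: a_r_coset_def')
    then have "i + (p - q) \<in> \<I>" "y = (i + (p - q)) + q"
      using I_closed(2) that by auto
    then show "y \<in> coset q"
      unfolding a_r_coset_def' by (metis (mono_tags, lifting) UN_I ore_extension_simps(5) singletonI)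
  qed
  assume "p - q \<in> \<I>"
  moreover from I_closed(4)[OF this] have "q - p \<in> \<I>"
    by simp
  ultimately show "coset p = coset q"
    using * by blast
qed

lemma coset_eq_0_iff: "coset p = \<zero>\<^bsub>\<A>\<^esub> \<longleftrightarrow> p \<in> \<I>"
  using coset_eq_iff[of p 0] pi.hom_zero by simp

lemma cosetE:
  assumes "x \<in> carrier \<A>"
  obtains p where "x = coset p"
  using that by (rule I.quotient_carrierE[OF assms])

lemma coset_pow: "coset (p [^]\<^bsub>\<R>\<^esub> (n::nat)) = coset p [^]\<^bsub>\<A>\<^esub> n"
  by (induction n) (simp_all add: coset_mult coset_one)

text \<open>The left annihilators of the powers of \<open>x\<close> lift to an ascending chain of
  left ideals of \<open>R\<close> that contain \<open>b\<close>.\<close>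

lemma kernel_chain:
  assumes "x \<in> carrier \<A>"
  obtains n where "\<And>c. c \<in> carrier \<A> \<Longrightarrow> c \<otimes>\<^bsub>\<A>\<^esub> x [^]\<^bsub>\<A>\<^esub> Suc n = \<zero>\<^bsub>\<A>\<^esub> \<Longrightarrow> c \<otimes>\<^bsub>\<A>\<^esub> x [^]\<^bsub>\<A>\<^esub> n = \<zero>\<^bsub>\<A>\<^esub>"
proof -
  obtain g where g: "x = coset g"
    using cosetE[OF assms] .
  define L where "L = (\<lambda>n. {c. c \<star> (g [^]\<^bsub>\<R>\<^esub> (n::nat)) \<in> \<I>})"
  have "left_ideal (L n)" for n
    unfolding left_ideal_def L_def
    using I_closed(1-3) by (simp add: distrib_right mult_assoc)
  moreover have "L n \<subseteq> L (Suc n)" for n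
    using I_right_closed by (auto simp: L_def mult_assoc[symmetric])
  moreover have "b \<in> L 0"
    using b_in_I by (simp add: L_def)
  ultimately obtain n where n: "L (Suc n) = L n"
    using ascending_chain[of L b] b_nonzero by metis
  have "c \<otimes>\<^bsub>\<A>\<^esub> x [^]\<^bsub>\<A>\<^esub> n = \<zero>\<^bsub>\<A>\<^esub>"
    if c: "c \<in> carrier \<A>" "c \<otimes>\<^bsub>\<A>\<^esub> x [^]\<^bsub>\<A>\<^esub> Suc n = \<zero>\<^bsub>\<A>\<^esub>" for c
  proof -
    obtain p where p: "c = coset p"
      using cosetE[OF c(1)] .
    have "p \<in> L (Suc n)"
      using c(2) unfolding L_def p g mem_Collect_eq coset_pow[symmetric] coset_mult[symmetric]
        coset_eq_0_iff .
    then have "p \<in> L n"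
      using n by simp
    then show ?thesis
      unfolding L_def p g mem_Collect_eq coset_pow[symmetric] coset_mult[symmetric] coset_eq_0_iff .
  qed
  then show ?thesis
    using that by blast
qed

text \<open>The left ideals generated by the powers of \<open>x\<close> lift to a descending chain
  in \<open>R\<close>. All its members contain \<I> and hence the common nonzero element
  \<open>b\<close>.\<close>

lemma image_chain:
  assumes "x \<in> carrier \<A>"
  shows "\<exists>n::nat. \<exists>c\<in>carrier \<A>. x [^]\<^bsub>\<A>\<^esub> n = c \<otimes>\<^bsub>\<A>\<^esub> x [^]\<^bsub>\<A>\<^esub> Suc n"
proof -
  obtain g where g: "x = coset g"
    using cosetE[OF assms] .
  define L where "L = (\<lambda>n. {p. \<exists>c. p - c \<star> (g [^]\<^bsub>\<R>\<^esub> (n::nat)) \<in> \<I>})"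
  have "left_ideal (L n)" for n
    unfolding left_ideal_def
  proof (intro conjI ballI allI)
    show "0 \<in> L n"
      using I_closed(1) unfolding L_def by (auto intro!: exI[of _ 0])
    fix p q assume q: "q \<in> L n"
    then obtain d where d: "q - d \<star> (g [^]\<^bsub>\<R>\<^esub> n) \<in> \<I>"
      by (auto simp: L_def)
    have "p \<star> (q - d \<star> (g [^]\<^bsub>\<R>\<^esub> n)) \<in> \<I>"
      using d by (rule I_closed(3))
    then have "p \<star> q - (p \<star> d) \<star> (g [^]\<^bsub>\<R>\<^esub> n) \<in> \<I>"
      by (simp only: mult_simps)
    then show "p \<star> q \<in> L n"
      unfolding L_def by blast
    assume "p \<in> L n"
    then obtain c where c: "p - c \<star> (g [^]\<^bsub>\<R>\<^esub> n) \<in> \<I>"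
      by (auto simp: L_def)
    have "p + q - (c + d) \<star> (g [^]\<^bsub>\<R>\<^esub> n) \<in> \<I>"
      using I_closed(2)[OF c d] by (simp add: distrib_right algebra_simps)
    then show "p + q \<in> L n"
      unfolding L_def by blast
  qed
  moreover have "L (Suc n) \<subseteq> L n" for n
  proof
    fix p assume "p \<in> L (Suc n)"
    then obtain c where "p - c \<star> (g [^]\<^bsub>\<R>\<^esub> Suc n) \<in> \<I>"
      by (auto simp: L_def)
    moreover have "g [^]\<^bsub>\<R>\<^esub> Suc n = g \<star> (g [^]\<^bsub>\<R>\<^esub> n)"
      using I.nat_pow_Suc2[of g n] by simp
    ultimately have "p - (c \<star> g) \<star> (g [^]\<^bsub>\<R>\<^esub> n) \<in> \<I>"
      by (simp only: mult_assoc)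
    then show "p \<in> L n"
      unfolding L_def by blast
  qed
  moreover have "b \<in> L n" for n
    using b_in_I unfolding L_def by (auto intro!: exI[of _ 0])
  ultimately obtain n where n: "L (Suc n) = L n"
    using descending_chain[of L b] b_nonzero by metis
  have "g [^]\<^bsub>\<R>\<^esub> n \<in> L n"
    using I_closed(1) unfolding L_def by (auto intro!: exI[of _ "[:1:]"])
  then obtain c where "g [^]\<^bsub>\<R>\<^esub> n - c \<star> (g [^]\<^bsub>\<R>\<^esub> Suc n) \<in> \<I>"
    unfolding n[symmetric] by (auto simp: L_def)
  then have "x [^]\<^bsub>\<A>\<^esub> n = coset c \<otimes>\<^bsub>\<A>\<^esub> x [^]\<^bsub>\<A>\<^esub> Suc n"
    unfolding g coset_pow[symmetric] coset_mult[symmetric] coset_eq_iff .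
  then show ?thesis
    by (intro exI[of _ n] bexI[of _ "coset c"] coset_closed)
qed

text \<open>The left annihilator of \<open>\<A> w\<close> is a twosided ideal; it contains \<open>u\<close> if \<open>u \<A> w = 0\<close>.\<close>

lemma idempotent_full:
  assumes u: "u \<in> carrier \<A>" "u \<otimes>\<^bsub>\<A>\<^esub> u = u" "u \<noteq> \<zero>\<^bsub>\<A>\<^esub>"
    and w: "w \<in> carrier \<A>" "w \<noteq> \<zero>\<^bsub>\<A>\<^esub>"
  obtains q where "q \<in> carrier \<A>" "u \<otimes>\<^bsub>\<A>\<^esub> q \<otimes>\<^bsub>\<A>\<^esub> w \<noteq> \<zero>\<^bsub>\<A>\<^esub>"
proof -
  obtain v where v: "u = coset v"
    using cosetE[OF u(1)] .
  obtain y where y: "w = coset y"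
    using cosetE[OF w(1)] .
  define N where "N = {p. \<forall>q. p \<star> q \<star> y \<in> \<I>}"
  have "\<exists>q. v \<star> q \<star> y \<notin> \<I>"
  proof (rule ccontr)
    assume "\<not> ?thesis"
    then have v_N: "v \<in> N"
      by (simp add: N_def)
    have v_I: "v \<notin> \<I>" "v \<star> v - v \<in> \<I>"
      using u(2,3) unfolding v coset_mult[symmetric] coset_eq_iff coset_eq_0_iff by simp_all
    have left: "left_ideal N"
      unfolding left_ideal_def N_def
      using I_closed(1-3) by (simp add: distrib_right mult_assoc)
    have right: "p \<star> q \<in> N" if "p \<in> N" for p q
    proof -
      have "p \<star> (q \<star> s) \<star> y \<in> \<I>" for s
        using that unfolding N_def by blast
      then show ?thesis
        unfolding N_def by (simp only: mult_assoc mem_Collect_eq) simp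
    qed
    have "p \<in> N" if "p \<in> \<I>" for p
      unfolding N_def mem_Collect_eq by (intro allI I_right_closed that)
    then have "N = UNIV"
      by (intro idempotent_in_twosided_ideal[OF left right _ v_N v_I] subsetI)
    then have "[:1:] \<star> [:1:] \<star> y \<in> \<I>"
      unfolding N_def by blast
    then show False
      using w(2) y by (simp add: coset_eq_0_iff)
  qed
  then obtain q where "v \<star> q \<star> y \<notin> \<I>"
    by blast
  then show ?thesis
    using that[of "coset q"] coset_closed
    unfolding v y coset_mult[symmetric] coset_eq_0_iff by blast
qed

end

section \<open>The corner attached to \<open>f\<close>: zero divisors and factorizations\<close>

locale split_bound = central_irreducible \<sigma> \<delta> b
  for \<sigma> \<delta> :: "'a::division_ring \<Rightarrow> 'a" and b :: "'a poly" +
  fixes f :: "'a poly" and e :: "'a poly set"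
  assumes ann: "ann_quotient \<R> f = \<I>"
    and e: "e \<in> carrier \<A>" "e \<otimes>\<^bsub>\<A>\<^esub> e = e" "PIdl\<^bsub>\<A>\<^esub> e = PIdl\<^bsub>\<A>\<^esub> (coset f)"
begin

definition u :: "'a poly set" where
  "u = \<one>\<^bsub>\<A>\<^esub> \<ominus>\<^bsub>\<A>\<^esub> e"

abbreviation corner_ring :: "('a poly set, 'a poly set) module" (\<open>\<B>\<close>)
  where "\<B> \<equiv> corner_algebra \<R> \<I> u"

lemma u_idempotent: "u \<in> carrier \<A>" "u \<otimes>\<^bsub>\<A>\<^esub> u = u" "e \<otimes>\<^bsub>\<A>\<^esub> u = \<zero>\<^bsub>\<A>\<^esub>" "u \<otimes>\<^bsub>\<A>\<^esub> e = \<zero>\<^bsub>\<A>\<^esub>"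
  "e \<oplus>\<^bsub>\<A>\<^esub> u = \<one>\<^bsub>\<A>\<^esub>"
proof -
  show u: "u \<in> carrier \<A>"
    using e(1) by (simp add: u_def)
  show eu: "e \<otimes>\<^bsub>\<A>\<^esub> u = \<zero>\<^bsub>\<A>\<^esub>" and "u \<otimes>\<^bsub>\<A>\<^esub> e = \<zero>\<^bsub>\<A>\<^esub>"
    using e(1,2) by (simp_all add: u_def pi.S.minus_eq pi.S.r_distr pi.S.l_distr pi.S.r_minus
        pi.S.l_minus pi.S.r_neg)
  show sum: "e \<oplus>\<^bsub>\<A>\<^esub> u = \<one>\<^bsub>\<A>\<^esub>"
    using e(1) by (simp add: u_def pi.S.minus_eq pi.S.a_lcomm[of e "\<one>\<^bsub>\<A>\<^esub>"] pi.S.r_neg)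
  have "(e \<oplus>\<^bsub>\<A>\<^esub> u) \<otimes>\<^bsub>\<A>\<^esub> u = u"
    unfolding sum using u by simp
  then show "u \<otimes>\<^bsub>\<A>\<^esub> u = u"
    using u e(1) eu by (simp add: pi.S.l_distr)
qed

lemma carrier_B: "carrier \<B> = pi.S.corner u"
  by (rule I.carrier_corner_algebra[OF u_idempotent(1,2)])

lemma zero_divisor_B_iff:
  "zero_divisor \<B> x \<longleftrightarrow> x \<in> pi.S.corner u \<and> x \<noteq> \<zero>\<^bsub>\<A>\<^esub> \<and>
    (\<exists>y\<in>pi.S.corner u. y \<noteq> \<zero>\<^bsub>\<A>\<^esub> \<and> (x \<otimes>\<^bsub>\<A>\<^esub> y = \<zero>\<^bsub>\<A>\<^esub> \<or> y \<otimes>\<^bsub>\<A>\<^esub> x = \<zero>\<^bsub>\<A>\<^esub>))"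
  by (simp add: zero_divisor_def carrier_B)

lemma I_subset_left_multiples: "\<I> \<subseteq> left_multiples f"
proof
  fix p assume "p \<in> \<I>"
  then have "p \<star> [:1:] \<in> left_multiples f"
    unfolding ann[symmetric] ann_quotient_R by blast
  then show "p \<in> left_multiples f"
    by simp
qed

lemma f_nonzero: "f \<noteq> 0"
  using I_subset_left_multiples b_in_I b_nonzero by auto

text \<open>Since \<open>R f\<close> contains \<I>, it is the full preimage of
  \<open>A a = A e\<close>, and \<open>A e\<close> is the left annihilator of the complementary
  idempotent \<open>u\<close>. This carries questions about \<open>R f\<close> over to the
  corner.\<close>

lemma left_multiples_f_iff: "p \<in> left_multiples f \<longleftrightarrow> coset p \<otimes>\<^bsub>\<A>\<^esub> u = \<zero>\<^bsub>\<A>\<^esub>"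
proof
  assume "p \<in> left_multiples f"
  then obtain q where "p = q \<star> f"
    by blast
  then have "coset p \<in> PIdl\<^bsub>\<A>\<^esub> (coset f)"
    using coset_closed by (auto simp: cgenideal_def coset_mult)
  then obtain x where "x \<in> carrier \<A>" "coset p = x \<otimes>\<^bsub>\<A>\<^esub> e"
    unfolding e(3)[symmetric] by (auto simp: cgenideal_def)
  then show "coset p \<otimes>\<^bsub>\<A>\<^esub> u = \<zero>\<^bsub>\<A>\<^esub>"
    using e(1) u_idempotent by (simp add: pi.S.m_assoc)
next
  assume *: "coset p \<otimes>\<^bsub>\<A>\<^esub> u = \<zero>\<^bsub>\<A>\<^esub>"
  have "coset p = coset p \<otimes>\<^bsub>\<A>\<^esub> (e \<oplus>\<^bsub>\<A>\<^esub> u)"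
    unfolding u_idempotent(5) using coset_closed by simp
  also have "\<dots> = coset p \<otimes>\<^bsub>\<A>\<^esub> e"
    using * coset_closed e(1) u_idempotent(1) by (simp add: pi.S.r_distr)
  finally have "coset p \<in> PIdl\<^bsub>\<A>\<^esub> e"
    using coset_closed by (auto simp: cgenideal_def)
  then obtain x where x: "x \<in> carrier \<A>" "coset p = x \<otimes>\<^bsub>\<A>\<^esub> coset f"
    unfolding e(3) by (auto simp: cgenideal_def)
  obtain q where q: "x = coset q"
    using cosetE[OF x(1)] .
  have "p - q \<star> f \<in> \<I>"
    using x(2) unfolding q coset_mult[symmetric] coset_eq_iff .
  then have "(p - q \<star> f) + q \<star> f \<in> left_multiples f"
    by (intro left_idealD(2)[OF left_ideal_left_multiples] left_multiplesI
        subsetD[OF I_subset_left_multiples])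
  then show "p \<in> left_multiples f"
    by simp
qed

text \<open>The three equations express \<open>R h = R f + R g\<close>, independently of how
  \<open>h\<close> is computed. Multiplying a Bezout relation by \<open>u\<close> from the right
  removes its \<open>f\<close> part.\<close>

lemma proper_factorization_of_zero_divisor:
  assumes g: "zero_divisor \<B> (coset g)"
    and h: "h = p \<star> f + q \<star> g" "f = h1 \<star> h" "g = d \<star> h"
  shows "proper_factorization \<R> f h1 h"
proof -
  let ?x = "coset g"
  obtain y where y: "y \<in> pi.S.corner u" "y \<noteq> \<zero>\<^bsub>\<A>\<^esub>"
    "?x \<otimes>\<^bsub>\<A>\<^esub> y = \<zero>\<^bsub>\<A>\<^esub> \<or> y \<otimes>\<^bsub>\<A>\<^esub> ?x = \<zero>\<^bsub>\<A>\<^esub>"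
    and x: "?x \<in> pi.S.corner u" "?x \<noteq> \<zero>\<^bsub>\<A>\<^esub>"
    using g unfolding zero_divisor_B_iff by blast
  note x' = pi.S.cornerD[OF x(1)]
  have "h \<notin> Units \<R>"
  proof
    assume "h \<in> Units \<R>"
    then obtain s where "s \<star> h = [:1:]"
      by (auto simp: Units_def)
    then have "(s \<star> p) \<star> f + (s \<star> q) \<star> g = [:1:]"
      unfolding h(1) by (simp add: mult_simps)
    then have "coset ((s \<star> p) \<star> f) \<oplus>\<^bsub>\<A>\<^esub> coset (s \<star> q) \<otimes>\<^bsub>\<A>\<^esub> ?x = \<one>\<^bsub>\<A>\<^esub>"
      unfolding coset_mult[symmetric] coset_add[symmetric] coset_one[symmetric] by simp
    then have "(coset ((s \<star> p) \<star> f) \<oplus>\<^bsub>\<A>\<^esub> coset (s \<star> q) \<otimes>\<^bsub>\<A>\<^esub> ?x) \<otimes>\<^bsub>\<A>\<^esub> u = u"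
      using u_idempotent(1) by simp
    moreover have "coset ((s \<star> p) \<star> f) \<otimes>\<^bsub>\<A>\<^esub> u = \<zero>\<^bsub>\<A>\<^esub>"
      using left_multiples_f_iff left_multiplesI by blast
    ultimately have c: "coset (s \<star> q) \<otimes>\<^bsub>\<A>\<^esub> ?x = u"
      using u_idempotent(1) coset_closed x' by (simp add: pi.S.l_distr pi.S.m_assoc)
    obtain n where "\<And>c. c \<in> carrier \<A> \<Longrightarrow> c \<otimes>\<^bsub>\<A>\<^esub> ?x [^]\<^bsub>\<A>\<^esub> Suc n = \<zero>\<^bsub>\<A>\<^esub> \<Longrightarrow>
        c \<otimes>\<^bsub>\<A>\<^esub> ?x [^]\<^bsub>\<A>\<^esub> n = \<zero>\<^bsub>\<A>\<^esub>"
      using kernel_chain[OF coset_closed[of g]] by blast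
    then have "y = \<zero>\<^bsub>\<A>\<^esub>"
      by (rule pi.S.left_invertible_not_zero_divisor[OF u_idempotent(1) x(1) y(1)
            coset_closed[of "s \<star> q"] c _ y(3)])
    with y(2) show False ..
  qed
  moreover have "h1 \<notin> Units \<R>"
  proof
    assume "h1 \<in> Units \<R>"
    then obtain s where "s \<star> h1 = [:1:]"
      by (auto simp: Units_def)
    then have "s \<star> f = h"
      unfolding h(2) mult_assoc[symmetric] by simp
    then have "g = (d \<star> s) \<star> f"
      using h(3) by (simp add: mult_assoc)
    then have "g \<in> left_multiples f"
      by (simp only: left_multiplesI)
    then show False
      using left_multiples_f_iff x x' by simp
  qed
  ultimately show ?thesis
    using h(2) by (simp add: proper_factorization_def)
qed

text \<open>\<open>A u\<close> is a copy of \<open>R/Rf\<close> in which \<open>w\<close> generates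
  the image of \<open>R h\<close>. If \<open>w\<close> were zero, \<open>h\<close> would lie in
  \<open>R f\<close> and \<open>g\<close> would be a unit; if \<open>w\<close> generated
  \<open>u\<close>, then \<open>h\<close> would be a unit.\<close>

lemma zero_divisor_of_proper_factorization:
  assumes "proper_factorization \<R> f g h"
  shows "\<exists>x. zero_divisor \<B> x"
proof (rule ccontr)
  assume no: "\<not> ?thesis"
  have f: "f = g \<star> h" and units: "g \<notin> Units \<R>" "h \<notin> Units \<R>"
    using assms by (simp_all add: proper_factorization_def)
  define w where "w = coset h \<otimes>\<^bsub>\<A>\<^esub> u"
  have w: "w \<in> carrier \<A>" "w \<otimes>\<^bsub>\<A>\<^esub> u = w"
    using u_idempotent coset_closed[of h] by (simp_all add: w_def pi.S.m_assoc)
  have "w \<noteq> \<zero>\<^bsub>\<A>\<^esub>"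
  proof
    assume "w = \<zero>\<^bsub>\<A>\<^esub>"
    then have "h \<in> left_multiples f"
      by (simp add: left_multiples_f_iff w_def)
    then obtain c where c: "h = c \<star> f"
      by auto
    then have "[:1:] \<star> h = (c \<star> g) \<star> h"
      using f by (simp add: mult_assoc)
    moreover have "h \<noteq> 0" "g \<noteq> 0"
      using f f_nonzero by auto
    ultimately have "c \<star> g = [:1:]"
      using mult_right_cancel[of h "[:1:]" "c \<star> g"] by simp
    moreover from this have "c \<noteq> 0"
      by auto
    ultimately have "degree g = 0"
      using degree_mult(1)[OF _ \<open>g \<noteq> 0\<close>, of c] by simp
    then show False
      using units(1) \<open>g \<noteq> 0\<close> by (simp add: Units_R)
  qed
  then have "u \<noteq> \<zero>\<^bsub>\<A>\<^esub>"
    using coset_closed[of h] unfolding w_def by (metis pi.S.r_null)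
  obtain q where q: "q \<in> carrier \<A>" "u \<otimes>\<^bsub>\<A>\<^esub> q \<otimes>\<^bsub>\<A>\<^esub> w \<noteq> \<zero>\<^bsub>\<A>\<^esub>"
    by (rule idempotent_full[OF u_idempotent(1,2) \<open>u \<noteq> \<zero>\<^bsub>\<A>\<^esub>\<close> w(1) \<open>w \<noteq> \<zero>\<^bsub>\<A>\<^esub>\<close>])
  have domain: "x = \<zero>\<^bsub>\<A>\<^esub> \<or> y = \<zero>\<^bsub>\<A>\<^esub>"
    if "x \<in> pi.S.corner u" "y \<in> pi.S.corner u" "x \<otimes>\<^bsub>\<A>\<^esub> y = \<zero>\<^bsub>\<A>\<^esub>" for x y
    using no that unfolding zero_divisor_B_iff by blast
  obtain c where c: "c \<in> carrier \<A>" "u = c \<otimes>\<^bsub>\<A>\<^esub> w"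
    using pi.S.division_corner_generates[OF u_idempotent(1,2) domain image_chain w q] by blast
  obtain p where p: "c = coset p"
    using cosetE[OF c(1)] .
  \<comment> \<open>So \<open>1 - p h\<close> is annihilated by \<open>u\<close> and lies in
    \<open>R f\<close>, which is contained in \<open>R h\<close>; this yields a left inverse of
    \<open>h\<close>.\<close>
  have "coset (p \<star> h) \<otimes>\<^bsub>\<A>\<^esub> u = coset [:1:] \<otimes>\<^bsub>\<A>\<^esub> u"
    using c(2) u_idempotent(1) coset_closed
    by (simp add: w_def p coset_mult coset_one pi.S.m_assoc)
  moreover have "coset [:1:] = coset ([:1:] - p \<star> h) \<oplus>\<^bsub>\<A>\<^esub> coset (p \<star> h)"
    by (simp flip: coset_add)
  ultimately have "coset ([:1:] - p \<star> h) \<otimes>\<^bsub>\<A>\<^esub> u = \<zero>\<^bsub>\<A>\<^esub>"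
    using u_idempotent(1) coset_closed by (simp add: pi.S.l_distr)
  then have "[:1:] - p \<star> h \<in> left_multiples f"
    by (simp only: left_multiples_f_iff)
  then obtain s where "[:1:] - p \<star> h = s \<star> f"
    by auto
  then have "[:1:] = (s \<star> g + p) \<star> h"
    using f by (simp add: distrib_right mult_assoc algebra_simps)
  then have *: "(s \<star> g + p) \<star> h = [:1:]" ..
  then have "h \<noteq> 0" "s \<star> g + p \<noteq> 0"
    by auto
  then have "degree h = 0"
    using degree_mult(1)[of "s \<star> g + p" h] * by simp
  then show False
    using units(2) \<open>h \<noteq> 0\<close> by (simp add: Units_R)
qed

text \<open>The annihilator of \<open>R/Rh\<close> is a twosided ideal containing \<I>, hence \<I>
  or some \<open>R X^m\<close>. The hypothesis \<open>simple\<close> excludes a larger ideal with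
  \<open>m > 0\<close>, and \<open>m = 0\<close> would make \<open>h\<close> a unit.\<close>

lemma is_bound_of_simple:
  assumes simple: "\<nexists>m::nat. m > 0 \<and> twosided \<R> (ore_X [^]\<^bsub>\<R>\<^esub> m) \<and> \<I> \<subset> PIdl\<^bsub>\<R>\<^esub> (ore_X [^]\<^bsub>\<R>\<^esub> m)"
    and h: "h \<notin> Units \<R>" "\<I> \<subseteq> ann_quotient \<R> h"
  shows "is_bound \<R> h b"
proof -
  let ?N = "ann_quotient \<R> h"
  have "left_ideal ?N"
    unfolding left_ideal_def ann_quotient_R
    using left_idealD(1-3)[OF left_ideal_left_multiples[of h]] by (simp add: distrib_right mult_assoc)
  moreover have "p \<star> q \<in> ?N" if "p \<in> ?N" for p q
    using that unfolding ann_quotient_R mem_Collect_eq by (simp only: mult_assoc) blast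
  ultimately consider "?N = \<I>" |
    m where "?N = left_multiples (monom 1 m)" "?N = range ((\<star>) (monom 1 m))"
    using twosided_ideal_cases[of ?N] h(2) by blast
  then have "?N = \<I>"
  proof cases
    case (2 m)
    show ?thesis
    proof (rule ccontr)
      assume "?N \<noteq> \<I>"
      moreover have "twosided \<R> (ore_X [^]\<^bsub>\<R>\<^esub> m)"
        using 2 by (simp add: twosided_iff ore_X_pow)
      ultimately have "m = 0"
        using simple 2(1) h(2) by (auto simp: ore_X_pow PIdl_R)
      then have "[:1:] \<in> ?N"
        using left_multiplesI[of "[:1:]" "monom 1 m"] 2(1) by (simp add: monom_0)
      then have "[:1:] \<star> p \<in> left_multiples h" for p
        unfolding ann_quotient_R by blast
      then have "left_multiples h = UNIV"
        by auto
      then show False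
        using h(1) left_multiples_UNIV_iff by simp
    qed
  qed
  moreover have "twosided \<R> b"
    unfolding twosided_iff using b_commute by simp
  ultimately show ?thesis
    by (simp add: is_bound_def PIdl_R)
qed

text \<open>For \<open>f = g h\<close>, the module \<open>R/Rh\<close> is a quotient of
  \<open>R/Rf\<close>, and \<open>R/Rg\<close> is isomorphic to its submodule \<open>Rh/Rf\<close>.
  Hence \<I> annihilates both; for \<open>g\<close> this is seen by cancelling
  \<open>h\<close>.\<close>

lemma is_bound_factors:
  assumes simple: "\<nexists>m::nat. m > 0 \<and> twosided \<R> (ore_X [^]\<^bsub>\<R>\<^esub> m) \<and> \<I> \<subset> PIdl\<^bsub>\<R>\<^esub> (ore_X [^]\<^bsub>\<R>\<^esub> m)"
    and "proper_factorization \<R> f g h"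
  shows "is_bound \<R> h b" "is_bound \<R> g b"
proof -
  have f: "f = g \<star> h" and units: "g \<notin> Units \<R>" "h \<notin> Units \<R>"
    using assms(2) by (simp_all add: proper_factorization_def)
  have h: "h \<noteq> 0"
    using f f_nonzero by auto
  have factor: "\<exists>c. p \<star> q = (c \<star> g) \<star> h" if "p \<in> \<I>" for p q
    using that unfolding ann[symmetric] ann_quotient_R by (auto simp: f mult_assoc)
  have "p \<star> q \<in> left_multiples h" if "p \<in> \<I>" for p q
    using factor[OF that, of q] by auto
  then have "\<I> \<subseteq> ann_quotient \<R> h"
    unfolding ann_quotient_R by blast
  then show "is_bound \<R> h b"
    using is_bound_of_simple[OF simple units(2)] by blast
  have "p \<star> q \<in> left_multiples g" if p: "p \<in> \<I>" for p q
  proof -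
    obtain c where "p \<star> (q \<star> h) = (c \<star> g) \<star> h"
      using factor[OF p] by blast
    then have "(p \<star> q) \<star> h = (c \<star> g) \<star> h"
      by (simp only: mult_assoc)
    then have "p \<star> q = c \<star> g"
      by (rule mult_right_cancel[OF h])
    then show ?thesis
      by (simp only: left_multiplesI)
  qed
  then have "\<I> \<subseteq> ann_quotient \<R> g"
    unfolding ann_quotient_R by blast
  then show "is_bound \<R> g b"
    using is_bound_of_simple[OF simple units(1)] by blast
qed

lemma zero_divisor_factors_correct:
  assumes "zero_divisor \<B> (coset g)" "zero_divisor_factors \<sigma> \<delta> f g = (h1, h)"
  shows "proper_factorization \<R> f h1 h"
proof -
  have h: "h = ore_gcrd \<sigma> \<delta> f g" "h1 = ore_quot \<sigma> \<delta> f h"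
    using assms(2) by (auto simp: zero_divisor_factors_def Let_def)
  obtain p q c d where *: "h = p \<star> f + q \<star> g" "f = c \<star> h" "g = d \<star> h"
    using ore_gcrd_correct(1)[of f g] ore_gcrd_correct(2)[of f g] ore_gcrd_correct(3)[of g f]
    unfolding h(1)[symmetric] by blast
  have "h \<noteq> 0"
    using *(2) f_nonzero by auto
  note div = ore_quot_rem[OF this, of f, folded h(2)]
  \<comment> \<open>A nonzero multiple of \<open>h\<close> has at least the degree of
    \<open>h\<close>, so the remainder vanishes and the computed quotient is the exact
    cofactor.\<close>
  have "(c - h1) \<star> h = ore_rem \<sigma> \<delta> f h"
    using div(1) *(2) by (simp add: diff_distrib_right algebra_simps)
  then have "ore_rem \<sigma> \<delta> f h = 0"
    using div(2) degree_mult(1)[OF _ \<open>h \<noteq> 0\<close>, of "c - h1"] by fastforce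
  then have "f = h1 \<star> h"
    using div(1) by simp
  then show ?thesis
    using proper_factorization_of_zero_divisor[OF assms(1) *(1) _ *(3)] by blast
qed

lemma assoc_algebra_B:
  assumes "Z = ring_center \<R>"
  shows "assoc_algebra (\<R>\<lparr>carrier := Z\<rparr> Quot (PIdl\<^bsub>\<R>\<lparr>carrier := Z\<rparr>\<^esub> b)) \<B>"
proof -
  interpret S: cring "\<R>\<lparr>carrier := ring_center \<R>\<rparr>"
    by (rule I.cring_ring_center)
  have "b \<in> ring_center \<R>"
    using central_b by (simp add: ring_center_R)
  then have "ideal (PIdl\<^bsub>\<R>\<lparr>carrier := ring_center \<R>\<rparr>\<^esub> b) (\<R>\<lparr>carrier := ring_center \<R>\<rparr>)"
    by (intro S.cgenideal_ideal) simp
  moreover have "PIdl\<^bsub>\<R>\<lparr>carrier := ring_center \<R>\<rparr>\<^esub> b \<subseteq> \<I>"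
    by (auto simp: cgenideal_def)
  ultimately show ?thesis
    unfolding assms by (rule I.assoc_algebra_corner_algebra[OF u_idempotent(1,2)])
qed

end

text \<open>The condition on powers of \<open>X\<close> in the last part matters. For a field
  \<open>D\<close>, an automorphism \<sigma> of order \<open>n \<ge> 2\<close>, \<delta> = 0,
  \<open>f = fstar = z = X^n\<close> and \<open>e\<close> zero, the zero divisor \<open>X\<close>
  yields \<open>h = X\<close>, whose bound is \<open>X\<close> and not \<open>X^n\<close>.\<close>

theorem proposition5p4:
  fixes \<sigma> \<delta> :: "'a::division_ring \<Rightarrow> 'a"
    and K :: "'a set" and z f fstar :: "'a poly" and r :: nat and e :: "'a poly set"
  defines "R \<equiv> ore_extension \<sigma> \<delta>"
  defines "C \<equiv> ring_center R"
  defines "Kz \<equiv> adjoin R K z"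
  defines "S \<equiv> R\<lparr>carrier := Kz\<rparr>"
  defines "Kf \<equiv> S Quot (PIdl\<^bsub>S\<^esub> fstar)"
  defines "I \<equiv> PIdl\<^bsub>R\<^esub> fstar"
  defines "A \<equiv> R Quot I"
  defines "a \<equiv> I +>\<^bsub>R\<^esub> f"
  defines "B \<equiv> corner_algebra R I (\<one>\<^bsub>A\<^esub> \<ominus>\<^bsub>A\<^esub> e)"
  assumes "skew_automorphism \<sigma>" and "skew_derivation \<sigma> \<delta>"
    and "free_of_rank R C r"
    and "central_subfield K" and "\<sigma> ` K \<subseteq> K" and "\<forall>k\<in>K. \<delta> k = 0"
    and "degree z > 0" and "C = Kz"
    and "\<forall>t. t \<noteq> 0 \<and> twosided R t \<longrightarrow>
           (\<exists>d m \<alpha>. d \<noteq> 0 \<and> \<alpha> \<in> Kz \<and> t = [:d:] \<otimes>\<^bsub>R\<^esub> (ore_X [^]\<^bsub>R\<^esub> (m::nat)) \<otimes>\<^bsub>R\<^esub> \<alpha>)"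
    and "is_bound R f fstar" and "fstar \<in> Kz" and "ring_irreducible\<^bsub>S\<^esub> fstar"
    and "e \<in> carrier A" and "e \<otimes>\<^bsub>A\<^esub> e = e" and "PIdl\<^bsub>A\<^esub> e = PIdl\<^bsub>A\<^esub> a"
  shows "assoc_algebra Kf B \<and>
    (reducible R f \<longleftrightarrow> (\<exists>x. zero_divisor B x)) \<and>
    (\<forall>g. zero_divisor B (I +>\<^bsub>R\<^esub> g) \<longrightarrow>
       (let (h1, h) = zero_divisor_factors \<sigma> \<delta> f g in
          proper_factorization R f h1 h \<and>
          ((\<nexists>m::nat. m > 0 \<and> twosided R (ore_X [^]\<^bsub>R\<^esub> m) \<and> I \<subset> PIdl\<^bsub>R\<^esub> (ore_X [^]\<^bsub>R\<^esub> m))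
             \<longrightarrow> is_bound R h fstar \<and> is_bound R h1 fstar)))"
proof -
  interpret skew_polynomials \<sigma> \<delta>
    by unfold_locales fact+
  interpret central_irreducible \<sigma> \<delta> fstar
  proof (rule central_irreducibleI)
    show "ring_center (ore_extension \<sigma> \<delta>) = Kz"
      using \<open>C = Kz\<close> unfolding C_def R_def .
    show "ring_irreducible\<^bsub>ore_extension \<sigma> \<delta>\<lparr>carrier := Kz\<rparr>\<^esub> fstar"
      using \<open>ring_irreducible\<^bsub>S\<^esub> fstar\<close> unfolding S_def R_def .
    show "\<forall>t. t \<noteq> 0 \<and> twosided (ore_extension \<sigma> \<delta>) t \<longrightarrow>
        (\<exists>d m \<alpha>. d \<noteq> 0 \<and> \<alpha> \<in> Kz \<and> t = [:d:] \<otimes>\<^bsub>ore_extension \<sigma> \<delta>\<^esub>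
          (ore_X [^]\<^bsub>ore_extension \<sigma> \<delta>\<^esub> (m::nat)) \<otimes>\<^bsub>ore_extension \<sigma> \<delta>\<^esub> \<alpha>)"
      \<comment> \<open>\<open>assms(18)\<close> is the hypothesis on the form of twosided
        polynomials.\<close>
      by (fact assms(18)[unfolded R_def])
  qed fact
  have I: "I = left_multiples fstar"
    unfolding I_def R_def by (rule PIdl_R)
  interpret split_bound \<sigma> \<delta> fstar f e
  proof
    show "ann_quotient (ore_extension \<sigma> \<delta>) f = left_multiples fstar"
      using \<open>is_bound R f fstar\<close> unfolding is_bound_def I[symmetric] I_def R_def by simp
  qed (use assms in \<open>simp_all add: I[symmetric] R_def\<close>)
  have B: "B = corner_algebra R I u"
    unfolding B_def A_def u_def I R_def ..
  have Z: "Kz = ring_center R"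
    using \<open>C = Kz\<close> unfolding C_def ..
  have alg: "assoc_algebra Kf B"
    unfolding Kf_def S_def B I R_def by (rule assoc_algebra_B) (unfold Z R_def, rule refl)
  have factors: "proper_factorization R f h1 h"
    if "zero_divisor B (I +>\<^bsub>R\<^esub> g)" "zero_divisor_factors \<sigma> \<delta> f g = (h1, h)" for g h1 h
    using zero_divisor_factors_correct that unfolding B I R_def by blast
  have "reducible R f" if x: "zero_divisor B x" for x
  proof -
    have "x \<in> carrier (ore_extension \<sigma> \<delta> Quot left_multiples fstar)"
      using x zero_divisor_B_iff pi.S.cornerD(1) unfolding B I R_def by blast
    then obtain g where "x = I +>\<^bsub>R\<^esub> g"
      unfolding I R_def by (rule cosetE)
    then show ?thesis
      using factors x unfolding reducible_def by (metis surj_pair)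
  qed
  moreover have "\<exists>x. zero_divisor B x" if "reducible R f"
    using that zero_divisor_of_proper_factorization unfolding reducible_def B I R_def by blast
  ultimately have "reducible R f \<longleftrightarrow> (\<exists>x. zero_divisor B x)"
    by blast
  moreover have "is_bound R h fstar \<and> is_bound R h1 fstar"
    if "proper_factorization R f h1 h"
      "\<nexists>m::nat. m > 0 \<and> twosided R (ore_X [^]\<^bsub>R\<^esub> m) \<and> I \<subset> PIdl\<^bsub>R\<^esub> (ore_X [^]\<^bsub>R\<^esub> m)" for h1 h
    using is_bound_factors[of h1 h] that unfolding I R_def by blast
  ultimately show ?thesis
    using alg factors unfolding Let_def by (simp only: split: prod.split) blast
qed

end
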